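(* Let $\Theta\subseteq\mathbb{R}^n$ and $\Xi\subseteq\mathbb{R}^d$ be nonempty and compact, with $\Xi$ convex. Let $\rho$ be a metric on $\Xi$ such that $(\Xi,\rho)$ is a complete, separable, geodesic metric space, let $p\ge1$, and equip $\mathcal P_p(\Xi)$ with the topology induced by the $p$-Wasserstein distance $W_p$ corresponding to $\rho$. Suppose that $\ell:\Theta\times\Xi\to\mathbb{R}$, $(\theta,\xi)\mapsto\ell(\theta,\xi)$, is jointly continuous. For each $k\in[K]$ let $\varepsilon_k>0$, let $\mathbb B_{\varepsilon_k}(\widehat{\mathbb P}_k)$ be the $p$-Wasserstein ball of radius $\varepsilon_k$ around $\widehat{\mathbb P}_k\in\mathcal P_p(\Xi)$, and let $U\subseteq\mathcal P_p(\Xi)^K$ be the set of all $(\widehat{\mathbb P}_1,\dots,\widehat{\mathbb P}_K)$ for which $\bigcap_{k=1}^K\mathbb B_{\varepsilon_k}(\widehat{\mathbb P}_k)$ has nonempty interior. Then the optimal value of the problem $$\inf_{\theta\in\Theta}\ \sup_{\mathbb Q\in\bigcap_{k=1}^K\mathbb B_{\varepsilon_k}(\widehat{\mathbb P}_k)}\ \int_\Xi\ell(\theta,\xi)\,\mathrm d\mathbb Q(\xi)$$ is continuous in $(\widehat{\mathbb P}_1,\dots,\widehat{\mathbb P}_K)$ on $U$.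
   Context: $\mathcal P_p(\Xi)$ is the set of Borel probability distributions on $\Xi$ with finite $p$-th moment, $W_p(\mathbb P_1,\mathbb P_2)=\big(\min_{\pi}\int\rho(\xi_1,\xi_2)^p\,\mathrm d\pi\big)^{1/p}$ with the minimum over couplings $\pi$ of $\mathbb P_1,\mathbb P_2$, and $\mathbb B_{\varepsilon}(\widehat{\mathbb P})=\{\mathbb Q\in\mathcal P_p(\Xi): W_p(\mathbb Q,\widehat{\mathbb P})\le\varepsilon\}$. $[K]=\{1,\dots,K\}$. The interior is taken in $(\mathcal P_p(\Xi),W_p)$. *)

theory Defs
  imports "HOL-Probability.Probability"
begin

text \<open>Following the library locale \<^locale>\<open>Metric_space\<close>, a metric on a subset \<open>X\<close> of a type
  is a total function whose definiteness and triangle inequality are only required on \<open>X\<close>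
  (its values off \<open>X\<close>, which must be symmetric and nonnegative, are never used; any metric on
  \<open>X\<close> can be extended by \<open>0\<close>).\<close>

definition geodesic_on :: "'a set \<Rightarrow> ('a \<Rightarrow> 'a \<Rightarrow> real) \<Rightarrow> bool" where
  "geodesic_on X \<rho> \<longleftrightarrow>
     (\<forall>x\<in>X. \<forall>y\<in>X. \<exists>\<gamma> :: real \<Rightarrow> 'a.
        \<gamma> ` {0..1} \<subseteq> X \<and> \<gamma> 0 = x \<and> \<gamma> 1 = y \<and>
        (\<forall>s\<in>{0..1}. \<forall>t\<in>{0..1}. \<rho> (\<gamma> s) (\<gamma> t) = \<bar>s - t\<bar> * \<rho> x y))"

abbreviation borel_on :: "'a::topological_space set \<Rightarrow> 'a measure" where
  "borel_on X \<equiv> restrict_space borel X"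

definition prob_measures_p ::
  "'a::topological_space set \<Rightarrow> ('a \<Rightarrow> 'a \<Rightarrow> real) \<Rightarrow> real \<Rightarrow> 'a measure set" where
  "prob_measures_p X \<rho> p =
     {Q. prob_space Q \<and> sets Q = sets (borel_on X) \<and>
         (\<exists>x\<^sub>0\<in>X. (\<integral>\<^sup>+x. ennreal (\<rho> x x\<^sub>0 powr p) \<partial>Q) < \<infinity>)}"

definition couplings ::
  "'a::topological_space set \<Rightarrow> 'a measure \<Rightarrow> 'a measure \<Rightarrow> ('a \<times> 'a) measure set" where
  "couplings X P Q =
     {\<pi>. sets \<pi> = sets (borel_on X \<Otimes>\<^sub>M borel_on X) \<and>
         distr \<pi> (borel_on X) fst = P \<and> distr \<pi> (borel_on X) snd = Q}"

text \<open>The transport cost is an infimum; on complete separable spaces it is attained, so that it is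
  the minimum over couplings. It is finite for measures with finite \<open>p\<close>-th moment, so that
  \<^const>\<open>enn2real\<close> loses no information there.\<close>

definition wasserstein ::
  "'a::topological_space set \<Rightarrow> ('a \<Rightarrow> 'a \<Rightarrow> real) \<Rightarrow> real \<Rightarrow> 'a measure \<Rightarrow> 'a measure \<Rightarrow> real" where
  "wasserstein X \<rho> p P Q =
     enn2real (INF \<pi>\<in>couplings X P Q. \<integral>\<^sup>+z. ennreal (\<rho> (fst z) (snd z) powr p) \<partial>\<pi>) powr (1 / p)"

definition wasserstein_ball ::
  "'a::topological_space set \<Rightarrow> ('a \<Rightarrow> 'a \<Rightarrow> real) \<Rightarrow> real \<Rightarrow> real \<Rightarrow> 'a measure \<Rightarrow> 'a measure set" where
  "wasserstein_ball X \<rho> p \<epsilon> P = {Q \<in> prob_measures_p X \<rho> p. wasserstein X \<rho> p Q P \<le> \<epsilon>}"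

definition wasserstein_topology ::
  "'a::topological_space set \<Rightarrow> ('a \<Rightarrow> 'a \<Rightarrow> real) \<Rightarrow> real \<Rightarrow> 'a measure topology" where
  "wasserstein_topology X \<rho> p =
     Metric_space.mtopology (prob_measures_p X \<rho> p) (wasserstein X \<rho> p)"

definition ball_intersection ::
  "'a::topological_space set \<Rightarrow> ('a \<Rightarrow> 'a \<Rightarrow> real) \<Rightarrow> real \<Rightarrow> nat \<Rightarrow> (nat \<Rightarrow> real) \<Rightarrow>
   (nat \<Rightarrow> 'a measure) \<Rightarrow> 'a measure set" where
  "ball_intersection X \<rho> p K \<epsilon> P = (\<Inter>k\<in>{1..K}. wasserstein_ball X \<rho> p (\<epsilon> k) (P k))"

definition admissible_centers ::
  "'a::topological_space set \<Rightarrow> ('a \<Rightarrow> 'a \<Rightarrow> real) \<Rightarrow> real \<Rightarrow> nat \<Rightarrow> (nat \<Rightarrow> real) \<Rightarrow>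
   (nat \<Rightarrow> 'a measure) set" where
  "admissible_centers X \<rho> p K \<epsilon> =
     {P \<in> {1..K} \<rightarrow>\<^sub>E prob_measures_p X \<rho> p.
        wasserstein_topology X \<rho> p interior_of ball_intersection X \<rho> p K \<epsilon> P \<noteq> {}}"

text \<open>Real-valued infimum and supremum are adequate: for a bounded loss and centers in
  \<^const>\<open>admissible_centers\<close> both range over nonempty bounded sets.\<close>

definition optimal_value ::
  "'b set \<Rightarrow> 'a::topological_space set \<Rightarrow> ('a \<Rightarrow> 'a \<Rightarrow> real) \<Rightarrow> real \<Rightarrow> nat \<Rightarrow> (nat \<Rightarrow> real) \<Rightarrow>
   ('b \<Rightarrow> 'a \<Rightarrow> real) \<Rightarrow> (nat \<Rightarrow> 'a measure) \<Rightarrow> real" where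
  "optimal_value \<Theta> X \<rho> p K \<epsilon> loss P =
     (INF \<theta>\<in>\<Theta>. SUP Q\<in>ball_intersection X \<rho> p K \<epsilon> P. \<integral>x. loss \<theta> x \<partial>Q)"

end

theory Submission
  imports Defs
begin

text \<open>
  The distance \<open>W = W\<^sub>p\<close> satisfies the triangle inequality, and \<open>W\<^sup>p\<close> is convex. An interior point of
  the intersection of the balls can be moved slightly towards each center in turn, which yields a
  Slater point \<open>S\<close> with \<open>W(S, P\<^sub>k) < \<epsilon>\<^sub>k\<close> for all \<open>k\<close>. If \<open>Q\<close> is feasible for centers \<open>P\<close> and \<open>P'\<close> is
  close to \<open>P\<close>, then by convexity \<open>t S + (1 - t) Q\<close> is feasible for \<open>P'\<close>, and passing
  from \<open>Q\<close> to this mixture changes the expected loss by at most \<open>2 t sup \<bar>loss\<bar>\<close>. This bound is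
  symmetric in \<open>P\<close> and \<open>P'\<close> and uniform in \<open>\<theta>\<close>, whence the optimal value is continuous.

  As \<open>\<rho>\<close> is only assumed to be Borel measurable, the cost need not be lower semicontinuous. The
  triangle inequality is therefore obtained by gluing couplings approximately along a
  countable partition into cells of small diameter, and the definiteness of \<open>W\<close> by an argument in the
  style of Lusin's theorem.
\<close>

section \<open>Minkowski inequality and gluing along a discrete factor\<close>

text \<open>For positive arguments this is \<open>powr_convex\<close>. If one argument is 0, the
  claim reduces to \<open>(s * z) powr p \<le> s * z powr p\<close> for \<open>0 < s < 1\<close>,
  which follows from \<open>s powr p \<le> s\<close>.\<close>

lemma convex_on_powr_nonneg:
  assumes "p \<ge> (1::real)"
  shows "convex_on {0..} (\<lambda>x. x powr p)"
proof (rule convex_onI)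
  fix t x y :: real
  assume t: "0 < t" "t < 1" and xy: "x \<in> {0..}" "y \<in> {0..}"
  have shrink: "(s * z) powr p \<le> s * z powr p" if "0 < s" "s < 1" "0 \<le> z" for s z :: real
  proof -
    have "s powr p \<le> s powr 1"
      using that assms by (intro powr_mono') auto
    then show ?thesis
      using that by (simp add: powr_mult mult_right_mono)
  qed
  have "((1 - t) * x + t * y) powr p \<le> (1 - t) * x powr p + t * y powr p"
  proof (cases "x = 0 \<or> y = 0")
    case True
    then show ?thesis
      using shrink[of "1 - t" x] shrink[of t y] t xy assms by auto
  next
    case False
    then show ?thesis
      using convex_onD[OF powr_convex[OF assms], of t x y] t xy by auto
  qed
  then show "((1 - t) *\<^sub>R x + t *\<^sub>R y) powr p \<le> (1 - t) * x powr p + t * y powr p"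
    by simp
qed (rule convex_real_interval)

text \<open>Minkowski's inequality, from convexity of \<open>x \<mapsto> x\<^sup>p\<close> applied to
  \<open>f + g = \<lambda> (f / \<lambda>) + (1 - \<lambda>) (g / (1 - \<lambda>))\<close> with \<open>\<lambda> = a / (a + b)\<close>.\<close>

lemma nn_integral_add_powr_le:
  fixes f g :: "'a \<Rightarrow> real"
  assumes p: "p \<ge> 1"
    and [measurable]: "f \<in> borel_measurable M" "g \<in> borel_measurable M"
    and nonneg: "\<And>x. f x \<ge> 0" "\<And>x. g x \<ge> 0"
    and ab: "a > 0" "b > 0"
    and f: "(\<integral>\<^sup>+x. ennreal (f x powr p) \<partial>M) \<le> ennreal (a powr p)"
    and g: "(\<integral>\<^sup>+x. ennreal (g x powr p) \<partial>M) \<le> ennreal (b powr p)"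
  shows "(\<integral>\<^sup>+x. ennreal ((f x + g x) powr p) \<partial>M) \<le> ennreal ((a + b) powr p)"
proof -
  define s where "s = a + b"
  have s: "s > 0" using ab by (simp add: s_def)
  \<comment> \<open>Convexity produces the factors \<open>(s / a) powr p\<close> and
    \<open>(s / b) powr p\<close>; the weights satisfy
    \<open>u * a powr p = a / s * s powr p\<close>, and likewise for \<open>v\<close>, so the two
    bounds add up to \<open>s powr p\<close>.\<close>
  define u v where "u = (s / a) powr p * (a / s)" and "v = (s / b) powr p * (b / s)"
  have uv: "u \<ge> 0" "v \<ge> 0" using ab s by (auto simp: u_def v_def)
  have pointwise: "(f x + g x) powr p \<le> u * f x powr p + v * g x powr p" for x
  proof -
    have "((1 - b / s) * (s / a * f x) + (b / s) * (s / b * g x)) powr p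
        \<le> (1 - b / s) * (s / a * f x) powr p + (b / s) * (s / b * g x) powr p"
      using convex_onD[OF convex_on_powr_nonneg[OF p], of "b / s" "s / a * f x" "s / b * g x"]
        ab s nonneg[of x] by (simp add: s_def)
    moreover have "1 - b / s = a / s" using s by (simp add: s_def field_simps)
    ultimately show ?thesis
      using ab s nonneg[of x] powr_mult[of "s / a" "f x" p] powr_mult[of "s / b" "g x" p]
      by (simp add: u_def v_def mult.assoc mult.left_commute)
  qed
  have "(\<integral>\<^sup>+x. ennreal ((f x + g x) powr p) \<partial>M)
      \<le> (\<integral>\<^sup>+x. ennreal u * ennreal (f x powr p) + ennreal v * ennreal (g x powr p) \<partial>M)"
    using pointwise uv
    by (intro nn_integral_mono) (simp add: ennreal_mult[symmetric] ennreal_plus[symmetric] del: ennreal_plus)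
  also have "\<dots> = ennreal u * (\<integral>\<^sup>+x. ennreal (f x powr p) \<partial>M)
      + ennreal v * (\<integral>\<^sup>+x. ennreal (g x powr p) \<partial>M)"
    by (simp add: nn_integral_add nn_integral_cmult)
  also have "\<dots> \<le> ennreal u * ennreal (a powr p) + ennreal v * ennreal (b powr p)"
    using f g by (intro add_mono mult_left_mono) auto
  also have "\<dots> = ennreal (u * a powr p + v * b powr p)"
    using uv by (simp add: ennreal_mult[symmetric] ennreal_plus[symmetric] del: ennreal_plus)
  also have "u * a powr p + v * b powr p = (a / s + b / s) * s powr p"
    using ab s by (simp add: u_def v_def powr_divide algebra_simps)
  also have "a / s + b / s = 1"
    using s by (simp add: s_def add_divide_distrib[symmetric])
  finally show ?thesis by (simp add: s_def)
qed

text \<open>Two laws with a common discrete factor are glued by making them conditionally independent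
  given that factor, so that no disintegration is needed.\<close>

lemma discrete_gluing:
  fixes f :: "'a \<Rightarrow> nat" and g :: "'b \<Rightarrow> nat"
  assumes "prob_space M" "prob_space N"
    and [measurable]: "f \<in> measurable M (count_space UNIV)" "g \<in> measurable N (count_space UNIV)"
    and eq: "distr M (count_space UNIV) f = distr N (count_space UNIV) g"
  shows "\<exists>\<Gamma>. sets \<Gamma> = sets (M \<Otimes>\<^sub>M N) \<and> distr \<Gamma> M fst = M \<and> distr \<Gamma> N snd = N \<and>
    (AE w in \<Gamma>. f (fst w) = g (snd w))"
proof -
  interpret M: prob_space M by fact
  interpret N: prob_space N by fact
  interpret pair_sigma_finite M N ..
  define q where "q j = emeasure (distr M (count_space UNIV) f) {j}" for j
  have q_M: "q j = emeasure M {x \<in> space M. f x = j}" for j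
    unfolding q_def by (subst emeasure_distr) (auto intro!: arg_cong[where f="emeasure M"])
  have q_N: "q j = emeasure N {x \<in> space N. g x = j}" for j
    unfolding q_def eq by (subst emeasure_distr) (auto intro!: arg_cong[where f="emeasure N"])
  \<comment> \<open>Cell \<open>j\<close> has mass \<open>q j\<close> under both laws, so its
    rectangle has product mass \<open>q j * q j\<close>; the density \<open>1 / q j\<close> corrects
    this to \<open>q j\<close>. For \<open>q j = 0\<close> the inverse is infinite, but such cells
    are null, whence the marginals are computed almost everywhere.\<close>
  define h where "h w = (if f (fst w) = g (snd w) then inverse (q (f (fst w))) else 0)" for w
  have [measurable]: "h \<in> borel_measurable (M \<Otimes>\<^sub>M N)"
  proof -
    have [measurable]: "q \<in> borel_measurable (count_space UNIV)" by simp
    have "Measurable.pred (M \<Otimes>\<^sub>M N) (\<lambda>w. \<exists>j. f (fst w) = j \<and> g (snd w) = j)"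
      by measurable
    then have [measurable]: "Measurable.pred (M \<Otimes>\<^sub>M N) (\<lambda>w. f (fst w) = g (snd w))"
      by (simp add: eq_commute)
    show ?thesis unfolding h_def by measurable
  qed
  define \<Gamma> where "\<Gamma> = density (M \<Otimes>\<^sub>M N) h"
  have inv: "inverse (q j) * q j = 1" if "q j \<noteq> 0" for j
    using that M.emeasure_finite by (metis ennreal_inverse_mult infinity_ennreal_def mult.commute q_M
        ennreal_mult_divide_eq ennreal_divide_self divide_ennreal_def top.not_eq_extremum)
  have "AE x in M. q (f x) \<noteq> 0"
  proof -
    have "AE x in M. f x \<noteq> j \<or> q j \<noteq> 0" for j
      by (cases "q j = 0") (auto simp: q_M intro!: AE_I'[of "{x\<in>space M. f x = j}"])
    then have "AE x in M. \<forall>j. f x \<noteq> j \<or> q j \<noteq> 0"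
      by (subst AE_all_countable) blast
    then show ?thesis by eventually_elim auto
  qed
  then have one_M: "AE x in M. (\<integral>\<^sup>+y. h (x, y) \<partial>N) = 1"
  proof eventually_elim
    case (elim x)
    have "(\<integral>\<^sup>+y. h (x, y) \<partial>N) = (\<integral>\<^sup>+y. inverse (q (f x)) * indicator {y\<in>space N. g y = f x} y \<partial>N)"
      by (intro nn_integral_cong) (auto simp: h_def)
    also have "\<dots> = inverse (q (f x)) * q (f x)"
      by (subst nn_integral_cmult_indicator) (auto simp: q_N)
    finally show ?case using inv elim by simp
  qed
  have "AE y in N. q (g y) \<noteq> 0"
  proof -
    have "AE y in N. g y \<noteq> j \<or> q j \<noteq> 0" for j
      by (cases "q j = 0") (auto simp: q_N intro!: AE_I'[of "{x\<in>space N. g x = j}"])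
    then have "AE y in N. \<forall>j. g y \<noteq> j \<or> q j \<noteq> 0"
      by (subst AE_all_countable) blast
    then show ?thesis by eventually_elim auto
  qed
  then have one_N: "AE y in N. (\<integral>\<^sup>+x. h (x, y) \<partial>M) = 1"
  proof eventually_elim
    case (elim y)
    have "(\<integral>\<^sup>+x. h (x, y) \<partial>M) = (\<integral>\<^sup>+x. inverse (q (g y)) * indicator {x\<in>space M. f x = g y} x \<partial>M)"
      by (intro nn_integral_cong) (auto simp: h_def)
    also have "\<dots> = inverse (q (g y)) * q (g y)"
      by (subst nn_integral_cmult_indicator) (auto simp: q_M)
    finally show ?case using inv elim by simp
  qed
  have fst_\<Gamma>: "distr \<Gamma> M fst = M"
  proof (rule measure_eqI)
    fix A assume "A \<in> sets (distr \<Gamma> M fst)"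
    then have A[measurable]: "A \<in> sets M" by simp
    have "emeasure (distr \<Gamma> M fst) A = (\<integral>\<^sup>+w. h w * indicator A (fst w) \<partial>(M \<Otimes>\<^sub>M N))"
      unfolding \<Gamma>_def
      by (subst emeasure_distr, measurable)
        (subst emeasure_density, auto intro!: nn_integral_cong simp: space_pair_measure indicator_def)
    also have "\<dots> = (\<integral>\<^sup>+x. \<integral>\<^sup>+y. h (x, y) * indicator A x \<partial>N \<partial>M)"
      by (subst N.nn_integral_fst[symmetric]) auto
    also have "\<dots> = (\<integral>\<^sup>+x. (\<integral>\<^sup>+y. h (x, y) \<partial>N) * indicator A x \<partial>M)"
      by (intro nn_integral_cong nn_integral_multc) simp
    also have "\<dots> = (\<integral>\<^sup>+x. indicator A x \<partial>M)"
      using one_M by (intro nn_integral_cong_AE) auto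
    finally show "emeasure (distr \<Gamma> M fst) A = emeasure M A" by simp
  qed simp
  have snd_\<Gamma>: "distr \<Gamma> N snd = N"
  proof (rule measure_eqI)
    fix A assume "A \<in> sets (distr \<Gamma> N snd)"
    then have A[measurable]: "A \<in> sets N" by simp
    have "emeasure (distr \<Gamma> N snd) A = (\<integral>\<^sup>+w. h w * indicator A (snd w) \<partial>(M \<Otimes>\<^sub>M N))"
      unfolding \<Gamma>_def
      by (subst emeasure_distr, measurable)
        (subst emeasure_density, auto intro!: nn_integral_cong simp: space_pair_measure indicator_def)
    also have "\<dots> = (\<integral>\<^sup>+y. \<integral>\<^sup>+x. h (x, y) * indicator A y \<partial>M \<partial>N)"
      by (subst nn_integral_snd[symmetric]) auto
    also have "\<dots> = (\<integral>\<^sup>+y. (\<integral>\<^sup>+x. h (x, y) \<partial>M) * indicator A y \<partial>N)"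
      by (intro nn_integral_cong nn_integral_multc) simp
    also have "\<dots> = (\<integral>\<^sup>+y. indicator A y \<partial>N)"
      using one_N by (intro nn_integral_cong_AE) auto
    finally show "emeasure (distr \<Gamma> N snd) A = emeasure N A" by simp
  qed simp
  have "AE w in \<Gamma>. f (fst w) = g (snd w)"
    unfolding \<Gamma>_def by (subst AE_density) (auto simp: h_def)
  moreover have "sets \<Gamma> = sets (M \<Otimes>\<^sub>M N)" by (simp add: \<Gamma>_def)
  ultimately show ?thesis using fst_\<Gamma> snd_\<Gamma> by blast
qed

section \<open>The Wasserstein triangle inequality\<close>

text \<open>Each summand is at most \<open>max u v\<close>. The crude constant is enough for
  finiteness of moments and costs.\<close>

lemma add_powr_le_two_powr:
  fixes u v :: real
  assumes "u \<ge> 0" "v \<ge> 0" "p \<ge> 0"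
  shows "(u + v) powr p \<le> 2 powr p * (u powr p + v powr p)"
proof -
  have "(u + v) powr p \<le> (2 * max u v) powr p"
    using assms by (intro powr_mono2) auto
  also have "\<dots> = 2 powr p * max u v powr p"
    using assms by (simp add: powr_mult)
  also have "\<dots> \<le> 2 powr p * (u powr p + v powr p)"
    by (auto simp: max_def)
  finally show ?thesis .
qed

text \<open>The metric \<open>\<rho>\<close> is tied to the Borel structure by joint measurability,
  so its topology may differ from the given one. Separability supplies countable measurable
  partitions, the Polish type inner regularity by compact sets.\<close>

locale transport_space = Metric_space X \<rho>
  for X :: "'a::polish_space set" and \<rho> +
  fixes p :: real
  assumes nonempty: "X \<noteq> {}"
    and X_borel [measurable]: "X \<in> sets borel"
    and separable: "separable_space mtopology"
    and dist_measurable [measurable]: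
      "(\<lambda>z. \<rho> (fst z) (snd z)) \<in> borel_measurable (borel_on X \<Otimes>\<^sub>M borel_on X)"
    and p_ge_1: "p \<ge> 1"
begin

abbreviation "\<P> \<equiv> prob_measures_p X \<rho> p"
abbreviation "W \<equiv> wasserstein X \<rho> p"
abbreviation "cost \<pi> \<equiv> \<integral>\<^sup>+z. ennreal (\<rho> (fst z) (snd z) powr p) \<partial>\<pi>"

section \<open>Moments and costs of couplings\<close>

lemma dense_sequence:
  obtains c :: "nat \<Rightarrow> 'a" where "\<And>n. c n \<in> X" "\<And>x e. x \<in> X \<Longrightarrow> e > 0 \<Longrightarrow> \<exists>n. \<rho> x (c n) < e"
proof -
  obtain C where C: "countable C" "C \<subseteq> X" "mtopology closure_of C = X"
    using separable by (auto simp: separable_space_def)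
  with nonempty have "C \<noteq> {}" by auto
  show thesis
  proof
    show "from_nat_into C n \<in> X" for n
      using from_nat_into[OF \<open>C \<noteq> {}\<close>] C by auto
    fix x and e :: real assume "x \<in> X" "e > 0"
    then obtain y where "y \<in> C" "\<rho> x y < e"
      using C(3) unfolding metric_closure_of by (auto simp: in_mball)
    then show "\<exists>n. \<rho> x (from_nat_into C n) < e"
      using from_nat_into_surj[OF C(1)] by metis
  qed
qed

lemma dist_measurable1 [measurable]:
  assumes "c \<in> X" shows "(\<lambda>x. \<rho> x c) \<in> borel_measurable (borel_on X)"
proof -
  have "(\<lambda>x. (x, c)) \<in> borel_on X \<rightarrow>\<^sub>M borel_on X \<Otimes>\<^sub>M borel_on X"
    using assms by (intro measurable_Pair) auto
  from measurable_compose[OF this dist_measurable] show ?thesis by simp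
qed

lemma prob_measuresD:
  assumes "Q \<in> \<P>" shows "prob_space Q" "sets Q = sets (borel_on X)" "space Q = X"
  using assms sets_eq_imp_space_eq[of Q "borel_on X"]
  by (auto simp: prob_measures_p_def space_restrict_space)

text \<open>The definition provides one base point with finite moment; the triangle inequality
  transfers this to every other one.\<close>

lemma moment_finite:
  assumes Q: "Q \<in> \<P>" and x: "x \<in> X"
  shows "(\<integral>\<^sup>+y. ennreal (\<rho> y x powr p) \<partial>Q) < \<infinity>"
proof -
  interpret prob_space Q using prob_measuresD[OF Q] by simp
  note [measurable_cong] = prob_measuresD(2)[OF Q]
  obtain x0 where x0: "x0 \<in> X" "(\<integral>\<^sup>+y. ennreal (\<rho> y x0 powr p) \<partial>Q) < \<infinity>"
    using Q by (auto simp: prob_measures_p_def)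
  have "(\<integral>\<^sup>+y. ennreal (\<rho> y x powr p) \<partial>Q)
      \<le> (\<integral>\<^sup>+y. ennreal (2 powr p) * (ennreal (\<rho> y x0 powr p) + ennreal (\<rho> x0 x powr p)) \<partial>Q)"
  proof (intro nn_integral_mono)
    fix y assume "y \<in> space Q"
    then have "\<rho> y x powr p \<le> (\<rho> y x0 + \<rho> x0 x) powr p"
      using prob_measuresD(3)[OF Q] p_ge_1 x x0 triangle by (intro powr_mono2) auto
    also have "\<dots> \<le> 2 powr p * (\<rho> y x0 powr p + \<rho> x0 x powr p)"
      using p_ge_1 by (intro add_powr_le_two_powr) auto
    finally show "ennreal (\<rho> y x powr p)
        \<le> ennreal (2 powr p) * (ennreal (\<rho> y x0 powr p) + ennreal (\<rho> x0 x powr p))"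
      by (simp add: ennreal_mult[symmetric] ennreal_plus[symmetric] del: ennreal_plus)
  qed
  also have "\<dots> = ennreal (2 powr p) * ((\<integral>\<^sup>+y. ennreal (\<rho> y x0 powr p) \<partial>Q) + ennreal (\<rho> x0 x powr p))"
    using x0(1) by (simp add: nn_integral_cmult nn_integral_add emeasure_space_1)
  also have "\<dots> < \<infinity>"
    using x0(2) by (simp add: ennreal_mult_less_top)
  finally show ?thesis .
qed

lemma couplingsD:
  assumes "\<pi> \<in> couplings X P Q"
  shows "sets \<pi> = sets (borel_on X \<Otimes>\<^sub>M borel_on X)" "space \<pi> = X \<times> X"
    "distr \<pi> (borel_on X) fst = P" "distr \<pi> (borel_on X) snd = Q"
  using assms sets_eq_imp_space_eq[of \<pi> "borel_on X \<Otimes>\<^sub>M borel_on X"]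
  by (auto simp: couplings_def space_pair_measure space_restrict_space)

lemma coupling_prob_space:
  assumes "\<pi> \<in> couplings X P Q" "prob_space P"
  shows "prob_space \<pi>"
proof -
  note [measurable_cong] = couplingsD(1)[OF assms(1)]
  show ?thesis
    using couplingsD(3)[OF assms(1)] assms(2)
    by (intro prob_space_distrD[of fst \<pi> "borel_on X"]) auto
qed

lemma nn_integral_coupling:
  assumes \<pi>: "\<pi> \<in> couplings X P Q" and f: "f \<in> borel_measurable (borel_on X)"
  shows "(\<integral>\<^sup>+z. f (fst z) \<partial>\<pi>) = (\<integral>\<^sup>+x. f x \<partial>P)" "(\<integral>\<^sup>+z. f (snd z) \<partial>\<pi>) = (\<integral>\<^sup>+y. f y \<partial>Q)"
proof -
  note [measurable_cong] = couplingsD(1)[OF \<pi>] and [measurable] = f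
  show "(\<integral>\<^sup>+z. f (fst z) \<partial>\<pi>) = (\<integral>\<^sup>+x. f x \<partial>P)"
    by (subst couplingsD(3)[OF \<pi>, symmetric], subst nn_integral_distr) auto
  show "(\<integral>\<^sup>+z. f (snd z) \<partial>\<pi>) = (\<integral>\<^sup>+y. f y \<partial>Q)"
    by (subst couplingsD(4)[OF \<pi>, symmetric], subst nn_integral_distr) auto
qed

text \<open>Going through \<open>x\<close> splits the cost into terms that depend on one coordinate
  each, hence on the marginals only. The cost is thus finite for every coupling of measures in
  \<open>\<P>\<close>.\<close>

lemma cost_le_moments:
  assumes \<pi>: "\<pi> \<in> couplings X P Q" and x: "x \<in> X"
  shows "cost \<pi> \<le> ennreal (2 powr p) *
    ((\<integral>\<^sup>+y. ennreal (\<rho> y x powr p) \<partial>P) + (\<integral>\<^sup>+y. ennreal (\<rho> y x powr p) \<partial>Q))"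
proof -
  note [measurable_cong] = couplingsD(1)[OF \<pi>]
  define m where "m y = ennreal (\<rho> y x powr p)" for y
  have [measurable]: "m \<in> borel_measurable (borel_on X)"
    unfolding m_def using x by measurable
  have "cost \<pi> \<le> (\<integral>\<^sup>+z. ennreal (2 powr p) * (m (fst z) + m (snd z)) \<partial>\<pi>)"
  proof (rule nn_integral_mono)
    fix z assume "z \<in> space \<pi>"
    then have "fst z \<in> X" "snd z \<in> X"
      unfolding couplingsD(2)[OF \<pi>] mem_Times_iff by simp_all
    then have "\<rho> (fst z) (snd z) powr p \<le> (\<rho> (fst z) x + \<rho> (snd z) x) powr p"
      using triangle[of "fst z" x "snd z"] commute[of x "snd z"] p_ge_1 x
      by (intro powr_mono2) simp_all
    also have "\<dots> \<le> 2 powr p * (\<rho> (fst z) x powr p + \<rho> (snd z) x powr p)"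
      using p_ge_1 by (intro add_powr_le_two_powr) auto
    finally show "ennreal (\<rho> (fst z) (snd z) powr p) \<le> ennreal (2 powr p) * (m (fst z) + m (snd z))"
      by (simp add: m_def ennreal_mult[symmetric] ennreal_plus[symmetric] del: ennreal_plus)
  qed
  also have "\<dots> = ennreal (2 powr p) * ((\<integral>\<^sup>+z. m (fst z) \<partial>\<pi>) + (\<integral>\<^sup>+z. m (snd z) \<partial>\<pi>))"
    by (subst nn_integral_cmult, measurable) (subst nn_integral_add, auto)
  also have "\<dots> = ennreal (2 powr p) * ((\<integral>\<^sup>+y. m y \<partial>P) + (\<integral>\<^sup>+y. m y \<partial>Q))"
    using nn_integral_coupling[OF \<pi>, of m] by simp
  finally show ?thesis by (simp only: m_def)
qed

text \<open>Finiteness of the infimum is what allows \<open>enn2real\<close> to be undone in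
  \<open>wasserstein\<close>.\<close>

lemma ex_finite_cost_coupling:
  assumes P: "P \<in> \<P>" and Q: "Q \<in> \<P>"
  shows "\<exists>\<pi>\<in>couplings X P Q. cost \<pi> < \<infinity>"
proof -
  interpret P: prob_space P using prob_measuresD[OF P] by simp
  interpret Q: prob_space Q using prob_measuresD[OF Q] by simp
  note [measurable_cong] = prob_measuresD(2)[OF P] prob_measuresD(2)[OF Q]
  \<comment> \<open>A constant factor imposes no constraint, so gluing along it supplies a
    coupling.\<close>
  have "distr P (count_space UNIV) (\<lambda>_. 0::nat) = distr Q (count_space UNIV) (\<lambda>_. 0::nat)"
    using P.distr_const[of "0::nat" "count_space UNIV"] Q.distr_const[of "0::nat" "count_space UNIV"]
    by simp
  from discrete_gluing[OF P.prob_space_axioms Q.prob_space_axioms measurable_const measurable_const this]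
  obtain \<pi> where \<pi>': "sets \<pi> = sets (P \<Otimes>\<^sub>M Q)" "distr \<pi> P fst = P" "distr \<pi> Q snd = Q"
    by auto
  have "distr \<pi> (borel_on X) fst = distr \<pi> P fst" "distr \<pi> (borel_on X) snd = distr \<pi> Q snd"
    using prob_measuresD(2)[OF P] prob_measuresD(2)[OF Q]
    by (simp_all only: distr_cong[of \<pi> \<pi> "borel_on X" P fst fst] distr_cong[of \<pi> \<pi> "borel_on X" Q snd snd])
  moreover have "sets \<pi> = sets (borel_on X \<Otimes>\<^sub>M borel_on X)"
    unfolding \<pi>'(1) by (intro sets_pair_measure_cong prob_measuresD(2) P Q)
  ultimately have \<pi>: "\<pi> \<in> couplings X P Q"
    by (simp add: couplings_def \<pi>'(2,3))
  obtain x where x: "x \<in> X" using nonempty by blast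
  note cost_le_moments[OF \<pi> x]
  also have "ennreal (2 powr p) *
      ((\<integral>\<^sup>+y. ennreal (\<rho> y x powr p) \<partial>P) + (\<integral>\<^sup>+y. ennreal (\<rho> y x powr p) \<partial>Q)) < \<infinity>"
    using moment_finite[OF P x] moment_finite[OF Q x] by (simp add: ennreal_mult_less_top)
  finally show ?thesis using \<pi> by blast
qed

section \<open>Distance bounds through couplings\<close>

text \<open>A strict bound on the infimum is met by some coupling; passing back from
  \<open>W\<close> to the infimum uses that the latter is finite.\<close>

lemma wasserstein_lessD:
  assumes P: "P \<in> \<P>" and Q: "Q \<in> \<P>" and less: "W P Q < a"
  shows "\<exists>\<pi>\<in>couplings X P Q. cost \<pi> \<le> ennreal (a powr p)"
proof -
  define T where "T = (INF \<pi>\<in>couplings X P Q. cost \<pi>)"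
  have T: "T < \<infinity>"
    using ex_finite_cost_coupling[OF P Q] by (auto simp: T_def INF_less_iff)
  have W: "W P Q = enn2real T powr (1 / p)"
    by (simp add: wasserstein_def T_def)
  have "enn2real T = W P Q powr p"
    using p_ge_1 by (simp add: W powr_powr)
  also have "\<dots> < a powr p"
    using less p_ge_1 by (intro powr_less_mono2) (auto simp: W)
  finally have "T < ennreal (a powr p)"
    using T by (cases T) (auto simp: ennreal_less_iff)
  then show ?thesis
    by (auto simp: T_def INF_less_iff intro: less_imp_le)
qed

lemma wasserstein_leI:
  assumes "\<pi> \<in> couplings X P Q" "cost \<pi> \<le> ennreal (a powr p)" "a \<ge> 0"
  shows "W P Q \<le> a"
proof -
  have "(INF \<pi>\<in>couplings X P Q. cost \<pi>) \<le> ennreal (a powr p)"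
    using assms by (blast intro: INF_lower2)
  then have "enn2real (INF \<pi>\<in>couplings X P Q. cost \<pi>) \<le> a powr p"
    using enn2real_leI by auto
  then have "W P Q \<le> (a powr p) powr (1 / p)"
    unfolding wasserstein_def using p_ge_1 by (intro powr_mono2) auto
  then show ?thesis using assms(3) p_ge_1 by (simp add: powr_powr)
qed

lemma wasserstein_nonneg: "W P Q \<ge> 0"
  by (simp add: wasserstein_def)

lemma wasserstein_self:
  assumes P: "P \<in> \<P>" shows "W P P = 0"
proof -
  note [measurable_cong] = prob_measuresD(2)[OF P]
  define \<pi> where "\<pi> = distr P (borel_on X \<Otimes>\<^sub>M borel_on X) (\<lambda>x. (x, x))"
  have "distr P (borel_on X) (\<lambda>x. x) = P"
    using prob_measuresD(2)[OF P] by (intro distr_id2) simp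
  then have \<pi>: "\<pi> \<in> couplings X P P"
    by (simp add: couplings_def \<pi>_def distr_distr comp_def)
  have "cost \<pi> = (\<integral>\<^sup>+x. ennreal (\<rho> x x powr p) \<partial>P)"
    unfolding \<pi>_def by (subst nn_integral_distr) auto
  also have "\<dots> = (\<integral>\<^sup>+x. 0 \<partial>P)"
    using prob_measuresD(3)[OF P] by (intro nn_integral_cong) simp
  finally have "W P P \<le> 0"
    using \<pi> by (intro wasserstein_leI[of \<pi>]) auto
  then show ?thesis using wasserstein_nonneg[of P P] by simp
qed

lemma wasserstein_commute: "W P Q = W Q P"
proof -
  have swap: "\<exists>\<pi>'\<in>couplings X Q P. cost \<pi>' = cost \<pi>" if \<pi>: "\<pi> \<in> couplings X P Q" for P Q \<pi>
  proof -
    note [measurable_cong] = couplingsD(1)[OF \<pi>]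
    define \<pi>' where "\<pi>' = distr \<pi> (borel_on X \<Otimes>\<^sub>M borel_on X) (\<lambda>z. (snd z, fst z))"
    have "\<pi>' \<in> couplings X Q P"
      using couplingsD[OF \<pi>] by (simp add: couplings_def \<pi>'_def distr_distr comp_def)
    moreover have "cost \<pi>' = cost \<pi>"
      unfolding \<pi>'_def by (subst nn_integral_distr) (auto simp: commute)
    ultimately show ?thesis by blast
  qed
  have sub: "cost ` couplings X P Q \<subseteq> cost ` couplings X Q P" for P Q
  proof
    fix c assume "c \<in> cost ` couplings X P Q"
    then obtain \<pi> where \<pi>: "\<pi> \<in> couplings X P Q" "c = cost \<pi>" by (rule imageE)
    from swap[OF \<pi>(1)] obtain \<pi>' where "\<pi>' \<in> couplings X Q P" "cost \<pi>' = cost \<pi>" by (rule bexE)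
    then show "c \<in> cost ` couplings X Q P" unfolding \<pi>(2) by (intro image_eqI) simp_all
  qed
  have "cost ` couplings X P Q = cost ` couplings X Q P"
    by (intro subset_antisym sub)
  then show ?thesis unfolding wasserstein_def by (simp only:)
qed

section \<open>Approximate gluing of couplings\<close>

text \<open>The cell of a point is the first index at which a dense sequence comes within
  \<open>\<eta> / 2\<close> of it; two points with the same index are compared through that member
  of the sequence.\<close>

lemma small_cells:
  assumes "\<eta> > 0"
  obtains i :: "'a \<Rightarrow> nat" where "i \<in> measurable (borel_on X) (count_space UNIV)"
    "\<And>x y. x \<in> X \<Longrightarrow> y \<in> X \<Longrightarrow> i x = i y \<Longrightarrow> \<rho> x y \<le> \<eta>"
proof -
  obtain c :: "nat \<Rightarrow> 'a" where c: "\<And>n. c n \<in> X" "\<And>x e. x \<in> X \<Longrightarrow> e > 0 \<Longrightarrow> \<exists>n. \<rho> x (c n) < e"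
    using dense_sequence by blast
  define i where "i x = (LEAST n. \<rho> x (c n) < \<eta> / 2)" for x
  have "i \<in> measurable (borel_on X) (count_space UNIV)"
    unfolding i_def using c(1) by measurable
  moreover have "\<rho> x y \<le> \<eta>" if "x \<in> X" "y \<in> X" "i x = i y" for x y
  proof -
    have i: "\<rho> x (c (i x)) < \<eta> / 2" if "x \<in> X" for x
      unfolding i_def by (rule LeastI_ex) (use c(2)[OF that, of "\<eta> / 2"] assms in simp)
    have "\<rho> x y \<le> \<rho> x (c (i x)) + \<rho> (c (i x)) y"
      using that c(1) by (intro triangle)
    moreover have "\<rho> (c (i x)) y < \<eta> / 2"
      using i[OF that(2)] unfolding that(3) by (subst commute)
    ultimately show ?thesis
      using i[OF that(1)] by linarith
  qed
  ultimately show thesis using that by blast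
qed

text \<open>The two copies of the middle point are made to share a cell rather than to coincide. The
  gap between them adds at most \<open>\<eta>\<close> to the path between the outer points, and
  Minkowski's inequality sums the three contributions.\<close>

lemma glue_couplings:
  assumes \<pi>1: "\<pi>1 \<in> couplings X P Q" and \<pi>2: "\<pi>2 \<in> couplings X Q R" and P: "prob_space P"
    and pos: "\<eta> > 0" "a > 0" "b > 0"
    and cost: "cost \<pi>1 \<le> ennreal (a powr p)" "cost \<pi>2 \<le> ennreal (b powr p)"
  shows "\<exists>\<pi>\<in>couplings X P R. cost \<pi> \<le> ennreal ((a + (\<eta> + b)) powr p)"
proof -
  note [measurable_cong] = couplingsD(1)[OF \<pi>1] couplingsD(1)[OF \<pi>2]
  interpret \<pi>1: prob_space \<pi>1 using coupling_prob_space[OF \<pi>1 P] .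
  have "prob_space Q"
    using \<pi>1.prob_space_distr[of snd "borel_on X"] couplingsD(4)[OF \<pi>1] by simp
  then interpret \<pi>2: prob_space \<pi>2 using coupling_prob_space[OF \<pi>2] by simp
  obtain i :: "'a \<Rightarrow> nat" where i [measurable]: "i \<in> measurable (borel_on X) (count_space UNIV)"
    and cell: "\<And>x y. x \<in> X \<Longrightarrow> y \<in> X \<Longrightarrow> i x = i y \<Longrightarrow> \<rho> x y \<le> \<eta>"
    using small_cells[OF pos(1)] by blast
  \<comment> \<open>The cell index of the middle point has the same law under both couplings, namely
    the image of \<open>Q\<close> under \<open>i\<close>.\<close>
  have "distr \<pi>1 (count_space UNIV) (\<lambda>z. i (snd z)) = distr (distr \<pi>1 (borel_on X) snd) (count_space UNIV) i"
    by (subst distr_distr) (auto simp: comp_def)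
  also have "\<dots> = distr (distr \<pi>2 (borel_on X) fst) (count_space UNIV) i"
    using couplingsD[OF \<pi>1] couplingsD[OF \<pi>2] by simp
  also have "\<dots> = distr \<pi>2 (count_space UNIV) (\<lambda>z. i (fst z))"
    by (subst distr_distr) (auto simp: comp_def)
  finally have "distr \<pi>1 (count_space UNIV) (\<lambda>z. i (snd z)) = distr \<pi>2 (count_space UNIV) (\<lambda>z. i (fst z))" .
  moreover have "(\<lambda>z. i (snd z)) \<in> measurable \<pi>1 (count_space UNIV)"
      "(\<lambda>z. i (fst z)) \<in> measurable \<pi>2 (count_space UNIV)"
    by measurable
  ultimately obtain \<Gamma> where \<Gamma>: "sets \<Gamma> = sets (\<pi>1 \<Otimes>\<^sub>M \<pi>2)" "distr \<Gamma> \<pi>1 fst = \<pi>1" "distr \<Gamma> \<pi>2 snd = \<pi>2"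
    "AE w in \<Gamma>. i (snd (fst w)) = i (fst (snd w))"
    using discrete_gluing[OF \<pi>1.prob_space_axioms \<pi>2.prob_space_axioms] by blast
  have sets_\<Gamma>: "sets \<Gamma> = sets ((borel_on X \<Otimes>\<^sub>M borel_on X) \<Otimes>\<^sub>M (borel_on X \<Otimes>\<^sub>M borel_on X))"
    unfolding \<Gamma>(1) by (intro sets_pair_measure_cong couplingsD(1)[OF \<pi>1] couplingsD(1)[OF \<pi>2])
  note [measurable_cong] = sets_\<Gamma>
  have space_\<Gamma>: "space \<Gamma> = (X \<times> X) \<times> (X \<times> X)"
    using sets_eq_imp_space_eq[OF sets_\<Gamma>] by (simp add: space_pair_measure space_restrict_space)
  interpret \<Gamma>: prob_space \<Gamma>
    using \<Gamma>(2) \<pi>1.prob_space_axioms by (intro prob_space_distrD[of fst \<Gamma> \<pi>1]) auto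
  define \<pi> where "\<pi> = distr \<Gamma> (borel_on X \<Otimes>\<^sub>M borel_on X) (\<lambda>w. (fst (fst w), snd (snd w)))"
  have "distr \<Gamma> (borel_on X) (\<lambda>w. fst (fst w)) = distr (distr \<Gamma> \<pi>1 fst) (borel_on X) fst"
    by (subst distr_distr) (auto simp: comp_def)
  moreover have "distr \<Gamma> (borel_on X) (\<lambda>w. snd (snd w)) = distr (distr \<Gamma> \<pi>2 snd) (borel_on X) snd"
    by (subst distr_distr) (auto simp: comp_def)
  ultimately have \<pi>: "\<pi> \<in> couplings X P R"
    using couplingsD(3)[OF \<pi>1] couplingsD(4)[OF \<pi>2]
    by (simp add: couplings_def \<pi>_def distr_distr comp_def \<Gamma>(2,3))
  let ?f = "\<lambda>w. \<rho> (fst (fst w)) (snd (fst w))" and ?g = "\<lambda>w. \<rho> (fst (snd w)) (snd (snd w))"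
  have "(\<integral>\<^sup>+w. ennreal (?f w powr p) \<partial>\<Gamma>) = cost (distr \<Gamma> \<pi>1 fst)"
    by (subst nn_integral_distr) auto
  then have f: "(\<integral>\<^sup>+w. ennreal (?f w powr p) \<partial>\<Gamma>) \<le> ennreal (a powr p)"
    using cost(1) \<Gamma>(2) by simp
  have "(\<integral>\<^sup>+w. ennreal (?g w powr p) \<partial>\<Gamma>) = cost (distr \<Gamma> \<pi>2 snd)"
    by (subst nn_integral_distr) auto
  then have g: "(\<integral>\<^sup>+w. ennreal (?g w powr p) \<partial>\<Gamma>) \<le> ennreal (b powr p)"
    using cost(2) \<Gamma>(3) by simp
  have "cost \<pi> = (\<integral>\<^sup>+w. ennreal (\<rho> (fst (fst w)) (snd (snd w)) powr p) \<partial>\<Gamma>)"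
    unfolding \<pi>_def by (subst nn_integral_distr) auto
  also have "\<dots> \<le> (\<integral>\<^sup>+w. ennreal ((?f w + (\<eta> + ?g w)) powr p) \<partial>\<Gamma>)"
  proof (intro nn_integral_mono_AE)
    show "AE w in \<Gamma>. ennreal (\<rho> (fst (fst w)) (snd (snd w)) powr p) \<le> ennreal ((?f w + (\<eta> + ?g w)) powr p)"
      using \<Gamma>(4) AE_space
    proof eventually_elim
      case (elim w)
      obtain x y y' z where w: "w = ((x, y), (y', z))" by (metis surj_pair)
      have X: "x \<in> X" "y \<in> X" "y' \<in> X" "z \<in> X"
        using elim(2) unfolding space_\<Gamma> w by simp_all
      have "\<rho> x z \<le> \<rho> x y + (\<eta> + \<rho> y' z)"
        using triangle[of x y z] triangle[of y y' z] cell[of y y'] X elim w by simp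
      then show ?case using w p_ge_1 by (intro ennreal_leI powr_mono2) auto
    qed
  qed
  also have "\<dots> \<le> ennreal ((a + (\<eta> + b)) powr p)"
  \<comment> \<open>Minkowski is applied twice; the inner use treats \<open>\<eta>\<close> as a
    constant function, for which the integral is \<open>\<eta> powr p\<close> because
    \<open>\<Gamma>\<close> has mass 1.\<close>
  proof (rule nn_integral_add_powr_le[OF p_ge_1])
    show "(\<integral>\<^sup>+w. ennreal ((\<eta> + ?g w) powr p) \<partial>\<Gamma>) \<le> ennreal ((\<eta> + b) powr p)"
      by (rule nn_integral_add_powr_le[OF p_ge_1])
        (use pos g in \<open>simp_all add: \<Gamma>.emeasure_space_1\<close>)
  qed (use pos f in simp_all)
  finally show ?thesis using \<pi> by blast
qed

lemma wasserstein_triangle: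
  assumes P: "P \<in> \<P>" and Q: "Q \<in> \<P>" and R: "R \<in> \<P>"
  shows "W P R \<le> W P Q + W Q R"
proof (rule field_le_epsilon)
  fix e :: real assume e: "e > 0"
  \<comment> \<open>Two thirds of \<open>e\<close> pay for the near-optimal couplings, the last one
    for the cell diameter.\<close>
  obtain \<pi>1 where \<pi>1: "\<pi>1 \<in> couplings X P Q" "cost \<pi>1 \<le> ennreal ((W P Q + e / 3) powr p)"
    using wasserstein_lessD[OF P Q, of "W P Q + e / 3"] e by auto
  obtain \<pi>2 where \<pi>2: "\<pi>2 \<in> couplings X Q R" "cost \<pi>2 \<le> ennreal ((W Q R + e / 3) powr p)"
    using wasserstein_lessD[OF Q R, of "W Q R + e / 3"] e by auto
  obtain \<pi> where \<pi>: "\<pi> \<in> couplings X P R"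
    "cost \<pi> \<le> ennreal ((W P Q + e / 3 + (e / 3 + (W Q R + e / 3))) powr p)"
    using glue_couplings[OF \<pi>1(1) \<pi>2(1) prob_measuresD(1)[OF P], of "e / 3" "W P Q + e / 3" "W Q R + e / 3"]
      \<pi>1(2) \<pi>2(2) e wasserstein_nonneg[of P Q] wasserstein_nonneg[of Q R] by auto
  have "W P R \<le> W P Q + e / 3 + (e / 3 + (W Q R + e / 3))"
    using wasserstein_leI[OF \<pi>] e wasserstein_nonneg[of P Q] wasserstein_nonneg[of Q R] by simp
  then show "W P R \<le> W P Q + W Q R + e" by simp
qed

end

section \<open>Definiteness of the Wasserstein distance\<close>

text \<open>Inner regularity, stated through the measure of the remainder so that the errors for
  countably many sets can be summed.\<close>

lemma compact_inner_approx:
  fixes N :: "'a::polish_space measure"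
  assumes "finite_measure N" and sets: "sets N = sets borel" and B: "B \<in> sets borel" and e: "e > 0"
  shows "\<exists>K\<subseteq>B. compact K \<and> measure N (B - K) < e"
proof -
  interpret finite_measure N by fact
  have fin: "emeasure N (space N) \<noteq> \<infinity>" by simp
  have "\<exists>K\<in>{K. K \<subseteq> B \<and> compact K}. emeasure N B < emeasure N K + ennreal e"
  proof (rule SUP_approx_ennreal[OF e _ inner_regular[OF sets fin B]])
    show "{K. K \<subseteq> B \<and> compact K} \<noteq> {}" by (metis (mono_tags) compact_empty empty_subsetI empty_iff mem_Collect_eq)
  qed simp
  then obtain K where K: "K \<subseteq> B" "compact K" "emeasure N B < emeasure N K + ennreal e"
    by blast
  have "measure N B < measure N K + e"
    using K(3) e by (simp add: emeasure_eq_measure ennreal_plus[symmetric] ennreal_less_iff del: ennreal_plus)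
  moreover have "measure N (B - K) = measure N B - measure N K"
    using K(1,2) B sets by (intro finite_measure_Diff) (auto simp: compact_imp_closed)
  ultimately have "measure N (B - K) < e" by linarith
  then show ?thesis using K(1,2) by blast
qed

section \<open>Agreement on metrically closed sets at distance zero\<close>

context transport_space begin

text \<open>Couplings of arbitrarily small cost exist, and by Markov's inequality they move only
  little mass by \<open>\<delta>\<close> or more. The rest of the mass of \<open>A\<close> ends up
  in \<open>A'\<close>.\<close>

lemma emeasure_le_of_wasserstein_zero:
  assumes P: "P \<in> \<P>" and Q: "Q \<in> \<P>" and zero: "W P Q = 0"
    and A: "A \<in> sets (borel_on X)" and A': "A' \<in> sets (borel_on X)"
    and \<delta>: "\<delta> > 0" and near: "\<And>x y. x \<in> A \<Longrightarrow> y \<in> X \<Longrightarrow> \<rho> x y < \<delta> \<Longrightarrow> y \<in> A'"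
  shows "emeasure P A \<le> emeasure Q A'"
proof (rule ennreal_le_epsilon)
  fix e :: real assume e: "e > 0"
  \<comment> \<open>This makes \<open>a powr p = \<delta> powr p * e\<close>, so that Markov's
    inequality bounds the far set by exactly \<open>e\<close>.\<close>
  define a where "a = \<delta> * e powr (1 / p)"
  have "a > 0" using \<delta> e by (simp add: a_def)
  then obtain \<pi> where \<pi>: "\<pi> \<in> couplings X P Q" "cost \<pi> \<le> ennreal (a powr p)"
    using wasserstein_lessD[OF P Q, of a] zero by auto
  note [measurable_cong] = couplingsD(1)[OF \<pi>(1)] and [measurable] = A A'
  let ?far = "{z \<in> space \<pi>. 1 \<le> ennreal (1 / \<delta> powr p) * ennreal (\<rho> (fst z) (snd z) powr p)}"
  have far: "emeasure \<pi> ?far \<le> ennreal e"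
  proof -
    have "emeasure \<pi> ?far \<le> ennreal (1 / \<delta> powr p) * cost \<pi>"
      using nn_integral_Markov_inequality[of "\<lambda>z. ennreal (\<rho> (fst z) (snd z) powr p)" "space \<pi>" \<pi>
          "ennreal (1 / \<delta> powr p)"]
      by (simp add: nn_integral_set_ennreal cong: nn_integral_cong)
    also have "\<dots> \<le> ennreal (1 / \<delta> powr p) * ennreal (a powr p)"
      using \<pi>(2) by (intro mult_left_mono) auto
    also have "\<dots> = ennreal e"
      using \<delta> e p_ge_1 by (simp add: ennreal_mult[symmetric] a_def powr_mult powr_powr)
    finally show ?thesis .
  qed
  have "emeasure P A = emeasure \<pi> {z \<in> space \<pi>. fst z \<in> A}"
    by (subst couplingsD(3)[OF \<pi>(1), symmetric], subst emeasure_distr)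
      (auto intro!: arg_cong[where f="emeasure \<pi>"])
  also have "\<dots> \<le> emeasure \<pi> ({z \<in> space \<pi>. snd z \<in> A'} \<union> ?far)"
  proof (rule emeasure_mono)
    show "{z \<in> space \<pi>. fst z \<in> A} \<subseteq> {z \<in> space \<pi>. snd z \<in> A'} \<union> ?far"
    proof (rule subsetI)
      fix z assume z: "z \<in> {z \<in> space \<pi>. fst z \<in> A}"
      then have "snd z \<in> X"
        using couplingsD(2)[OF \<pi>(1)] by (simp add: mem_Times_iff)
      show "z \<in> {z \<in> space \<pi>. snd z \<in> A'} \<union> ?far"
      proof (cases "\<rho> (fst z) (snd z) < \<delta>")
        case True
        then show ?thesis using near[of "fst z" "snd z"] z \<open>snd z \<in> X\<close> by simp
      next
        case False
        then have "\<delta> powr p \<le> \<rho> (fst z) (snd z) powr p"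
          using \<delta> p_ge_1 by (intro powr_mono2) auto
        then have "1 \<le> 1 / \<delta> powr p * \<rho> (fst z) (snd z) powr p"
          using \<delta> by (simp add: field_simps)
        then have "1 \<le> ennreal (1 / \<delta> powr p) * ennreal (\<rho> (fst z) (snd z) powr p)"
          by (subst ennreal_mult[symmetric]) (simp_all add: ennreal_ge_1)
        then show ?thesis using z by simp
      qed
    qed
  qed measurable
  also have "\<dots> \<le> emeasure \<pi> {z \<in> space \<pi>. snd z \<in> A'} + emeasure \<pi> ?far"
    by (rule emeasure_subadditive) measurable
  also have "emeasure \<pi> {z \<in> space \<pi>. snd z \<in> A'} = emeasure Q A'"
    by (subst couplingsD(4)[OF \<pi>(1), symmetric], subst emeasure_distr)
      (auto intro!: arg_cong[where f="emeasure \<pi>"])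
  finally show "emeasure P A \<le> emeasure Q A' + ennreal e"
    using far by (meson add_left_mono order_trans)
qed

lemma inverse_Suc_less:
  fixes d :: real assumes "d > 0" obtains k where "1 / real (Suc k) < d"
  using reals_Archimedean[OF assms] by (auto simp: inverse_eq_divide)

lemma ball_in_borel [measurable]: "c \<in> X \<Longrightarrow> {x \<in> X. \<rho> x c < r} \<in> sets (borel_on X)"
proof -
  assume [measurable]: "c \<in> X"
  have "{x \<in> space (borel_on X). \<rho> x c < r} \<in> sets (borel_on X)" by measurable
  then show ?thesis by (simp add: space_restrict_space)
qed

text \<open>An open set is a countable union of balls with centers in a dense sequence and radii
  \<open>1 / Suc k\<close>. Shrinking all these radii by \<open>1 / Suc m\<close> leaves that margin
  inside \<open>U\<close>, and every point of \<open>U\<close> survives for large \<open>m\<close>.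
  The balls are Borel because \<open>\<rho>\<close> is measurable.\<close>

lemma open_approx:
  assumes U: "openin mtopology U"
  obtains V :: "nat \<Rightarrow> 'a set" where "\<And>m. V m \<in> sets (borel_on X)" "incseq V" "(\<Union>m. V m) = U"
    "\<And>m x y. x \<in> V m \<Longrightarrow> y \<in> X \<Longrightarrow> \<rho> x y < 1 / real (Suc m) \<Longrightarrow> y \<in> U"
proof -
  obtain c :: "nat \<Rightarrow> 'a" where c: "\<And>n. c n \<in> X" "\<And>x e. x \<in> X \<Longrightarrow> e > 0 \<Longrightarrow> \<exists>n. \<rho> x (c n) < e"
    using dense_sequence by blast
  define J where "J = {(n, k). {x \<in> X. \<rho> x (c n) < 1 / real (Suc k)} \<subseteq> U}"
  define V where "V m = (\<Union>(n, k)\<in>J. {x \<in> X. \<rho> x (c n) < 1 / real (Suc k) - 1 / real (Suc m)})" for m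
  have V_iff: "x \<in> V m \<longleftrightarrow> (\<exists>n k. (n, k) \<in> J \<and> x \<in> X \<and> \<rho> x (c n) < 1 / real (Suc k) - 1 / real (Suc m))"
    for x m unfolding V_def by (simp only: UN_iff Bex_def split_paired_Ex prod.case mem_Collect_eq)
  have "V m \<in> sets (borel_on X)" for m
    unfolding V_def using c(1) by (intro sets.countable_UN') (auto intro: ball_in_borel)
  moreover have "incseq V"
  proof (rule incseq_SucI, rule subsetI)
    fix m x assume "x \<in> V m"
    then obtain n k where "(n, k) \<in> J" "x \<in> X" "\<rho> x (c n) < 1 / real (Suc k) - 1 / real (Suc m)"
      using V_iff by blast
    moreover have "1 / real (Suc (Suc m)) \<le> 1 / real (Suc m)" by (simp add: field_simps)
    ultimately have "\<rho> x (c n) < 1 / real (Suc k) - 1 / real (Suc (Suc m))" by linarith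
    then show "x \<in> V (Suc m)" using V_iff \<open>(n, k) \<in> J\<close> \<open>x \<in> X\<close> by blast
  qed
  moreover have "y \<in> U" if xV: "x \<in> V m" and yX: "y \<in> X" and xy: "\<rho> x y < 1 / real (Suc m)" for m x y
  proof -
    obtain n k where nk: "(n, k) \<in> J" "x \<in> X" "\<rho> x (c n) < 1 / real (Suc k) - 1 / real (Suc m)"
      using xV V_iff by blast
    have "\<rho> y (c n) \<le> \<rho> y x + \<rho> x (c n)" by (rule triangle[OF yX nk(2) c(1)])
    moreover have "\<rho> y x = \<rho> x y" by (rule commute)
    ultimately have "\<rho> y (c n) < 1 / real (Suc k)" using nk(3) xy by linarith
    then show ?thesis using nk(1) yX unfolding J_def by blast
  qed
  moreover have "(\<Union>m. V m) = U"
  proof (intro equalityI subsetI)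
    fix x assume "x \<in> (\<Union>m. V m)"
    then obtain m n k where nk: "(n, k) \<in> J" "x \<in> X" "\<rho> x (c n) < 1 / real (Suc k) - 1 / real (Suc m)"
      using V_iff by blast
    have "1 / real (Suc m) > 0" by simp
    then have "\<rho> x (c n) < 1 / real (Suc k)" using nk(3) by linarith
    then show "x \<in> U" using nk(1,2) unfolding J_def by blast
  next
    fix x assume x: "x \<in> U"
    then obtain r where r: "r > 0" "mball x r \<subseteq> U" and xX: "x \<in> X"
      using U unfolding openin_mtopology by blast
    \<comment> \<open>A ball of radius below \<open>r / 2\<close> that contains \<open>x\<close>
      lies inside \<open>mball x r\<close>.\<close>
    obtain k where k: "1 / real (Suc k) < r / 2" using inverse_Suc_less[of "r / 2"] r(1) by auto
    obtain n where n: "\<rho> x (c n) < 1 / real (Suc k)" using c(2)[OF xX, of "1 / real (Suc k)"] by auto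
    have "{y \<in> X. \<rho> y (c n) < 1 / real (Suc k)} \<subseteq> U"
    proof
      fix y assume y: "y \<in> {y \<in> X. \<rho> y (c n) < 1 / real (Suc k)}"
      have "\<rho> x y \<le> \<rho> x (c n) + \<rho> (c n) y" using xX y c(1) by (intro triangle) auto
      moreover have "\<rho> (c n) y = \<rho> y (c n)" by (rule commute)
      ultimately have "\<rho> x y < r" using y n k by simp
      then show "y \<in> U" using r(2) xX y by (auto simp: in_mball)
    qed
    then have J: "(n, k) \<in> J" by (simp add: J_def)
    obtain m where "1 / real (Suc m) < 1 / real (Suc k) - \<rho> x (c n)"
      using inverse_Suc_less[of "1 / real (Suc k) - \<rho> x (c n)"] n by auto
    then have "\<rho> x (c n) < 1 / real (Suc k) - 1 / real (Suc m)" by linarith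
    then have "x \<in> V m" using V_iff J xX by blast
    then show "x \<in> (\<Union>m. V m)" by blast
  qed
  ultimately show thesis using that by blast
qed

text \<open>Each approximation \<open>V m\<close> has a margin in \<open>U\<close>, so the
  comparison of neighboring sets applies to it; continuity from below passes to \<open>U\<close>.
  The same union shows that \<open>U\<close> is Borel.\<close>

lemma emeasure_openin_le_of_wasserstein_zero:
  assumes P: "P \<in> \<P>" and Q: "Q \<in> \<P>" and zero: "W P Q = 0" and U: "openin mtopology U"
  shows "U \<in> sets (borel_on X)" "emeasure P U \<le> emeasure Q U"
proof -
  obtain V :: "nat \<Rightarrow> 'a set" where V: "\<And>m. V m \<in> sets (borel_on X)" "incseq V" "(\<Union>m. V m) = U"
    and near: "\<And>m x y. x \<in> V m \<Longrightarrow> y \<in> X \<Longrightarrow> \<rho> x y < 1 / real (Suc m) \<Longrightarrow> y \<in> U"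
    using open_approx[OF U] by blast
  show U: "U \<in> sets (borel_on X)"
    unfolding V(3)[symmetric] using V(1) by blast
  have "range V \<subseteq> sets P" using V(1) prob_measuresD(2)[OF P] by blast
  then have "emeasure P U = (SUP m. emeasure P (V m))"
    using SUP_emeasure_incseq[of V P] V(2,3) by simp
  also have "\<dots> \<le> emeasure Q U"
  proof (rule SUP_least)
    fix m
    show "emeasure P (V m) \<le> emeasure Q U"
      by (rule emeasure_le_of_wasserstein_zero[OF P Q zero V(1) U, of "1 / real (Suc m)"])
        (use near in auto)
  qed
  finally show "emeasure P U \<le> emeasure Q U" .
qed

text \<open>Symmetry turns the inequality on open sets into an equality, and complements carry it to
  closed sets, which can serve for approximation from inside.\<close>

lemma measure_closedin_eq_of_wasserstein_zero:
  assumes P: "P \<in> \<P>" and Q: "Q \<in> \<P>" and zero: "W P Q = 0" and F: "closedin mtopology F"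
  shows "measure P F = measure Q F"
proof -
  interpret P: prob_space P using prob_measuresD(1)[OF P] .
  interpret Q: prob_space Q using prob_measuresD(1)[OF Q] .
  have zero': "W Q P = 0" using zero wasserstein_commute[of P Q] by simp
  have U: "openin mtopology (X - F)" and FX: "F \<subseteq> X"
    using F by (auto simp: closedin_def)
  have "emeasure P (X - F) = emeasure Q (X - F)"
    using emeasure_openin_le_of_wasserstein_zero(2)[OF P Q zero U]
      emeasure_openin_le_of_wasserstein_zero(2)[OF Q P zero' U] by (rule antisym)
  then have eq: "measure P (X - F) = measure Q (X - F)" by (simp add: measure_def)
  have "X - F \<in> sets (borel_on X)"
    by (rule emeasure_openin_le_of_wasserstein_zero(1)[OF P Q zero U])
  then have "measure P (space P - (X - F)) = measure Q (space Q - (X - F))"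
    using P.prob_compl[of "X - F"] Q.prob_compl[of "X - F"] eq
      prob_measuresD(2)[OF P] prob_measuresD(2)[OF Q] by simp
  moreover have "X - (X - F) = F" using FX by blast
  ultimately show ?thesis
    unfolding prob_measuresD(3)[OF P] prob_measuresD(3)[OF Q] by simp
qed

text \<open>A Lusin-type argument: the balls of a countable base of the metric \<open>\<rho>\<close> are all clopen relative
  to a suitable compact set of almost full measure. The identity is therefore continuous
  from this set to \<open>(X, \<rho>)\<close>, so that its compact subsets are closed for \<open>\<rho>\<close>, even though
  \<open>\<rho>\<close> need not induce the original topology.\<close>

lemma closedin_inner_approx:
  assumes P: "P \<in> \<P>" and A: "A \<in> sets (borel_on X)" and e: "e > 0"
  shows "\<exists>F\<subseteq>A. closedin mtopology F \<and> F \<in> sets (borel_on X) \<and> measure P A \<le> measure P F + e"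
proof -
  interpret P: prob_space P using prob_measuresD(1)[OF P] .
  note sets_P [measurable_cong] = prob_measuresD(2)[OF P]
  have A_borel: "A \<in> sets borel" "A \<subseteq> X"
    using A X_borel by (auto simp: sets_restrict_space_iff)
  \<comment> \<open>Extending \<open>P\<close> by zero to the whole Polish space makes inner
    regularity available.\<close>
  define N where "N = distr P borel (\<lambda>x. x)"
  have id_measurable: "(\<lambda>x. x) \<in> P \<rightarrow>\<^sub>M borel"
    unfolding measurable_cong_sets[OF sets_P refl] by (intro measurable_restrict_space1) simp
  interpret N: prob_space N
    unfolding N_def by (intro P.prob_space_distr id_measurable)
  have sets_N: "sets N = sets borel" by (simp add: N_def)
  have N_eq: "measure N B = measure P B" if "B \<in> sets borel" "B \<subseteq> X" for B
  proof -
    have "measure N B = measure P (B \<inter> space P)"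
      unfolding N_def using that(1) by (simp add: measure_distr[OF id_measurable] Int_def vimage_def)
    also have "B \<inter> space P = B" using that(2) prob_measuresD(3)[OF P] by blast
    finally show ?thesis .
  qed
  have approx: "\<exists>K\<subseteq>B. compact K \<and> measure N (B - K) < \<eta>" if "B \<in> sets borel" "\<eta> > 0" for B \<eta>
    using compact_inner_approx[OF N.finite_measure_axioms sets_N that] .

  obtain c :: "nat \<Rightarrow> 'a" where c: "\<And>n. c n \<in> X" "\<And>x e. x \<in> X \<Longrightarrow> e > 0 \<Longrightarrow> \<exists>n. \<rho> x (c n) < e"
    using dense_sequence by blast
  \<comment> \<open>\<open>prod_decode\<close> enumerates all pairs of a center and a radius, so
    that \<open>B\<close> is a sequence.\<close>
  define r where "r j = 1 / real (Suc (snd (prod_decode j)))" for j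
  define b where "b j = c (fst (prod_decode j))" for j
  define B where "B j = {x \<in> X. \<rho> x (b j) < r j}" for j
  have B_borel: "B j \<in> sets borel" for j
    using ball_in_borel[of "b j" "r j"] c(1) X_borel by (simp add: B_def b_def sets_restrict_space_iff)
  \<comment> \<open>Each index has two exceptional sets, one in \<open>B j\<close> and one in its
    complement, so together they cost at most \<open>e / 2\<close>; the other half is spent on
    \<open>A - A0\<close>.\<close>
  define \<eta> where "\<eta> j = e / 4 * (1 / 2) ^ Suc j" for j :: nat
  have \<eta>: "\<eta> j > 0" for j using e by (simp add: \<eta>_def)
  have "\<forall>j. \<exists>C\<subseteq>B j. compact C \<and> measure N (B j - C) < \<eta> j"
    using approx B_borel \<eta> by blast
  then obtain C where C: "\<And>j. C j \<subseteq> B j" "\<And>j. compact (C j)" "\<And>j. measure N (B j - C j) < \<eta> j"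
    by metis
  have "\<forall>j. \<exists>D\<subseteq>- B j. compact D \<and> measure N (- B j - D) < \<eta> j"
    using approx borel_comp[OF B_borel] \<eta> by blast
  then obtain D where D: "\<And>j. D j \<subseteq> - B j" "\<And>j. compact (D j)" "\<And>j. measure N (- B j - D j) < \<eta> j"
    by metis
  obtain A0 where A0: "A0 \<subseteq> A" "compact A0" "measure N (A - A0) < e / 2"
    using approx[OF A_borel(1), of "e / 2"] e by auto
  \<comment> \<open>On \<open>F\<close> the ball \<open>B j\<close> agrees with \<open>C j\<close>
    and its complement with \<open>D j\<close>. Both are compact, so \<open>B j\<close> is
    relatively clopen in \<open>F\<close>.\<close>
  define F where "F = A0 \<inter> (\<Inter>j. C j \<union> D j)"
  have "closed (\<Inter>j. C j \<union> D j)"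
    using C(2) D(2) by (intro closed_INT ballI closed_Un compact_imp_closed)
  then have F_compact: "compact F" unfolding F_def using A0(2) by (rule compact_Int_closed[rotated])
  have FA: "F \<subseteq> A" using A0(1) by (auto simp: F_def)
  have F_borel: "F \<in> sets borel" using F_compact by (intro borel_closed compact_imp_closed)

  have N_sets: "A \<in> sets N" "A0 \<in> sets N" "F \<in> sets N"
    using A_borel F_borel A0(2) by (simp_all add: sets_N borel_closed compact_imp_closed)
  have C_borel: "C j \<in> sets borel" and D_borel: "D j \<in> sets borel" for j
    using C(2) D(2) by (simp_all add: borel_closed compact_imp_closed)
  define E where "E j = (B j - C j) \<union> (- B j - D j)" for j
  have E_sets: "E j \<in> sets N" for j
    unfolding E_def sets_N by (intro sets.Un sets.Diff borel_comp B_borel C_borel D_borel)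
  have E_le: "measure N (E j) \<le> e / 2 * (1 / 2) ^ Suc j" for j
  proof -
    have "measure N (E j) \<le> measure N (B j - C j) + measure N (- B j - D j)"
      unfolding E_def by (intro measure_Un_le; unfold sets_N; intro sets.Diff borel_comp B_borel C_borel D_borel)
    then show ?thesis using C(3)[of j] D(3)[of j] by (simp add: \<eta>_def)
  qed
  have sums: "(\<lambda>j. e / 2 * (1 / 2) ^ Suc j) sums (e / 2 * 1)"
    by (intro sums_mult power_half_series)
  have E_summable: "summable (\<lambda>j. measure N (E j))"
    by (rule summable_comparison_test'[OF sums_summable[OF sums], of 0]) (use E_le in simp)
  have "measure N (\<Union>j. E j) \<le> (\<Sum>j. measure N (E j))"
    using E_sets E_summable by (intro N.finite_measure_subadditive_countably) auto
  also have "\<dots> \<le> (\<Sum>j. e / 2 * (1 / 2) ^ Suc j)"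
    using E_le E_summable sums_summable[OF sums] by (rule suminf_le)
  also have "\<dots> = e / 2" using sums_unique[OF sums] by simp
  finally have E: "measure N (\<Union>j. E j) \<le> e / 2" .
  have "measure N A \<le> measure N (F \<union> ((A - A0) \<union> (\<Union>j. E j)))"
  proof (rule N.finite_measure_mono)
    show "A \<subseteq> F \<union> ((A - A0) \<union> (\<Union>j. E j))"
      unfolding F_def E_def by blast
    show "F \<union> ((A - A0) \<union> (\<Union>j. E j)) \<in> sets N"
      using E_sets N_sets by blast
  qed
  also have "\<dots> \<le> measure N F + measure N ((A - A0) \<union> (\<Union>j. E j))"
    using E_sets N_sets by (intro measure_Un_le) blast+
  also have "measure N ((A - A0) \<union> (\<Union>j. E j)) \<le> measure N (A - A0) + measure N (\<Union>j. E j)"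
    using E_sets N_sets by (intro measure_Un_le) blast+
  finally have "measure N A \<le> measure N F + e" using A0(3) E by linarith
  then have "measure P A \<le> measure P F + e"
    using N_eq A_borel F_borel FA by (metis subset_trans)
  moreover have "F \<in> sets (borel_on X)"
    using F_borel FA A_borel X_borel by (auto simp: sets_restrict_space_iff)
  moreover have "closedin mtopology F"
    unfolding closedin_metric
  proof (intro conjI allI impI)
    show "F \<subseteq> X" using FA A_borel(2) by (rule subset_trans)
    fix x assume x: "x \<in> X - F"
    \<comment> \<open>Balls indexed by \<open>J\<close> keep a distance greater than
      \<open>r j\<close> from \<open>x\<close>. They cover \<open>F\<close>, and replacing each
      \<open>B j\<close> by the open set \<open>- D j\<close> lets compactness select finitely many
      of them.\<close>
    define J where "J = {j. \<rho> x (b j) > 2 * r j}"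
    have cover: "F \<subseteq> (\<Union>j\<in>J. - D j)"
    proof
      fix y assume y: "y \<in> F"
      then have yX: "y \<in> X" using \<open>F \<subseteq> X\<close> by blast
      have "\<rho> x y > 0" using x y yX by (metis DiffE mdist_pos_less)
      \<comment> \<open>The third leaves \<open>\<rho> x (c n) > 3 / Suc k - 1 / Suc k\<close>, that
        is, more than twice the radius.\<close>
      then obtain k where k: "1 / real (Suc k) < \<rho> x y / 3"
        using inverse_Suc_less[of "\<rho> x y / 3"] by auto
      obtain n where n: "\<rho> y (c n) < 1 / real (Suc k)"
        using c(2)[OF yX, of "1 / real (Suc k)"] by auto
      define j where "j = prod_encode (n, k)"
      have j: "b j = c n" "r j = 1 / real (Suc k)" by (simp_all add: j_def b_def r_def)
      have "\<rho> x y \<le> \<rho> x (c n) + \<rho> (c n) y"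
        using x yX c(1) by (intro triangle) auto
      moreover have "\<rho> (c n) y = \<rho> y (c n)" by (rule commute)
      ultimately have "\<rho> x (c n) > 2 * (1 / real (Suc k))" using k n by linarith
      then have "j \<in> J" by (simp add: J_def j)
      moreover have "y \<in> B j" using n yX by (simp add: B_def j)
      ultimately show "y \<in> (\<Union>j\<in>J. - D j)" using D(1) by blast
    qed
    have opn: "open (- D j)" if "j \<in> J" for j
      using compact_imp_closed[OF D(2)] by (rule open_Compl)
    obtain J' where J': "J' \<subseteq> J" "finite J'" "F \<subseteq> (\<Union>j\<in>J'. - D j)"
      by (rule compactE_image[OF F_compact opn cover])
    \<comment> \<open>Inserting 1 keeps the minimum meaningful when \<open>J'\<close> is
      empty.\<close>
    define \<delta> where "\<delta> = Min (insert 1 (r ` J'))"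
    have "\<delta> > 0" using J'(2) by (auto simp: \<delta>_def r_def)
    moreover have "disjnt F (mball x \<delta>)"
      unfolding disjnt_iff
    proof (intro allI notI)
      fix y assume y: "y \<in> F \<and> y \<in> mball x \<delta>"
      then obtain j where j: "j \<in> J'" "y \<notin> D j" using J'(3) by blast
      then have "y \<in> C j" using y by (auto simp: F_def)
      then have "y \<in> B j" using C(1) by blast
      then have "\<rho> y (b j) < r j" by (simp add: B_def)
      moreover have "\<rho> x (b j) > 2 * r j" using j(1) J'(1) by (auto simp: J_def)
      moreover have "\<rho> x (b j) \<le> \<rho> x y + \<rho> y (b j)"
        using x y \<open>F \<subseteq> X\<close> c(1) by (intro triangle) (auto simp: b_def)
      moreover have "\<rho> x y < \<delta>" using y by (simp add: in_mball)
      moreover have "\<delta> \<le> r j" using J'(2) j(1) by (auto simp: \<delta>_def)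
      ultimately show False by linarith
    qed
    ultimately show "\<exists>r>0. disjnt F (mball x r)" by blast
  qed
  ultimately show ?thesis using FA by blast
qed

text \<open>Closed subsets with arbitrarily small defect carry the comparison from closed sets to
  all measurable sets; exchanging the roles gives equality.\<close>

lemma wasserstein_zero_imp_eq:
  assumes P: "P \<in> \<P>" and Q: "Q \<in> \<P>" and zero: "W P Q = 0"
  shows "P = Q"
proof -
  have le: "measure P A \<le> measure Q A"
    if P: "P \<in> \<P>" and Q: "Q \<in> \<P>" and zero: "W P Q = 0" and A: "A \<in> sets (borel_on X)" for P Q A
  proof (rule field_le_epsilon)
    interpret Q: prob_space Q using prob_measuresD(1)[OF Q] .
    fix e :: real assume "e > 0"
    then obtain F where F: "F \<subseteq> A" "closedin mtopology F" "measure P A \<le> measure P F + e"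
      using closedin_inner_approx[OF P A] by blast
    have "measure P F = measure Q F"
      by (rule measure_closedin_eq_of_wasserstein_zero[OF P Q zero F(2)])
    moreover have "measure Q F \<le> measure Q A"
      using F(1) A prob_measuresD(2)[OF Q] by (intro Q.finite_measure_mono) simp_all
    ultimately show "measure P A \<le> measure Q A + e" using F(3) by linarith
  qed
  interpret P: prob_space P using prob_measuresD(1)[OF P] .
  interpret Q: prob_space Q using prob_measuresD(1)[OF Q] .
  show ?thesis
  proof (rule measure_eqI)
    show "sets P = sets Q" using prob_measuresD(2)[OF P] prob_measuresD(2)[OF Q] by simp
    fix A assume "A \<in> sets P"
    then have A: "A \<in> sets (borel_on X)" using prob_measuresD(2)[OF P] by simp
    have "measure P A = measure Q A"
      using le[OF P Q zero A] le[OF Q P _ A] zero wasserstein_commute[of P Q] by simp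
    then show "emeasure P A = emeasure Q A"
      by (simp add: P.emeasure_eq_measure Q.emeasure_eq_measure)
  qed
qed

lemma Metric_space_wasserstein: "Metric_space \<P> W"
proof
  show "0 \<le> W P Q" for P Q by (rule wasserstein_nonneg)
  show "W P Q = W Q P" for P Q by (rule wasserstein_commute)
  show "W P Q = 0 \<longleftrightarrow> P = Q" if "P \<in> \<P>" "Q \<in> \<P>" for P Q
    using wasserstein_zero_imp_eq[OF that] wasserstein_self[OF that(1)] by blast
  show "W P R \<le> W P Q + W Q R" if "P \<in> \<P>" "Q \<in> \<P>" "R \<in> \<P>" for P Q R
    using wasserstein_triangle[OF that] .
qed

end

section \<open>Mixtures and Slater points\<close>

text \<open>The convex combination \<open>t P + (1 - t) Q\<close> for
  \<open>0 \<le> t \<le> 1\<close>, realized by choosing the measure with a biased coin; integrals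
  and marginals then come from the laws of \<open>bind\<close>.\<close>

definition mix :: "real \<Rightarrow> 'a measure \<Rightarrow> 'a measure \<Rightarrow> 'a measure" where
  "mix t P Q = measure_pmf (bernoulli_pmf t) \<bind> (\<lambda>b. if b then P else Q)"

lemma mix_kernel:
  assumes "prob_space P" "prob_space Q" "sets P = sets S" "sets Q = sets S"
  shows "(\<lambda>b. if b then P else Q) \<in> measure_pmf M \<rightarrow>\<^sub>M subprob_algebra S"
  using assms by (auto simp: space_subprob_algebra prob_space_imp_subprob_space)

lemma sets_mix:
  assumes "sets P = sets S" "sets Q = sets S"
  shows "sets (mix t P Q) = sets S"
  unfolding mix_def using assms by (intro sets_bind) auto

lemma nn_integral_mix:
  assumes "prob_space P" "prob_space Q" "sets P = sets S" "sets Q = sets S"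
    and "f \<in> borel_measurable S" "0 \<le> t" "t \<le> 1"
  shows "(\<integral>\<^sup>+x. f x \<partial>mix t P Q) = ennreal t * (\<integral>\<^sup>+x. f x \<partial>P) + ennreal (1 - t) * (\<integral>\<^sup>+x. f x \<partial>Q)"
  unfolding mix_def
  by (subst nn_integral_bind[OF assms(5) mix_kernel[OF assms(1-4)]])
    (use assms in \<open>simp add: mult.commute\<close>)

lemma prob_space_mix:
  assumes "prob_space P" "prob_space Q" "sets P = sets S" "sets Q = sets S"
  shows "prob_space (mix t P Q)"
  unfolding mix_def
  by (rule prob_space.prob_space_bind[OF prob_space_measure_pmf _ mix_kernel[OF assms]])
    (use assms in simp)

lemma distr_mix:
  assumes "prob_space P" "prob_space Q" "sets P = sets S" "sets Q = sets S" "f \<in> S \<rightarrow>\<^sub>M S'"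
  shows "distr (mix t P Q) S' f = mix t (distr P S' f) (distr Q S' f)"
  unfolding mix_def
  by (subst distr_bind[OF mix_kernel[OF assms(1-4)] _ assms(5)])
    (simp_all add: if_distrib[of "\<lambda>N. distr N S' f"])

lemma mix_same:
  assumes "prob_space P" shows "mix t P P = P"
  unfolding mix_def if_cancel
  by (rule bind_const'[OF prob_space_measure_pmf prob_space_imp_subprob_space[OF assms]])

lemma integral_mix:
  fixes f :: "'a \<Rightarrow> real"
  assumes "prob_space P" "prob_space Q" "sets P = sets S" "sets Q = sets S"
    and f: "f \<in> borel_measurable S" "\<And>x. x \<in> space S \<Longrightarrow> \<bar>f x\<bar> \<le> B" and "0 \<le> t" "t \<le> 1"
  shows "(\<integral>x. f x \<partial>mix t P Q) = t * (\<integral>x. f x \<partial>P) + (1 - t) * (\<integral>x. f x \<partial>Q)"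
proof -
  have "(\<integral>x. f x \<partial>mix t P Q)
      = (\<integral>b. integral\<^sup>L (if b then P else Q) f \<partial>measure_pmf (bernoulli_pmf t))"
    unfolding mix_def
  proof (rule integral_bind[OF f mix_kernel[OF assms(1-4)]])
    show "finite_measure (measure_pmf (bernoulli_pmf t))" by (rule measure_pmf.finite_measure_axioms)
    show "AE b in measure_pmf (bernoulli_pmf t).
        emeasure (if b then P else Q) (space (if b then P else Q)) \<le> ennreal 1"
      using assms(1,2) by (simp add: prob_space.emeasure_space_1)
  qed
  then show ?thesis using assms(7,8) by (simp add: mult.commute)
qed

text \<open>At \<open>d = 0\<close> the inequality is strict, as \<open>a < \<epsilon>\<close> and
  \<open>t > 0\<close>; by continuity it persists for small \<open>d\<close>. The \<open>d\<close>
  on the left absorbs a non-strict bound or a shifted center, the one on the right records a strict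
  gain.\<close>

lemma powr_slack:
  fixes a \<epsilon> t p :: real
  assumes "0 \<le> a" "a < \<epsilon>" "0 < t" "t < 1" "p \<ge> 1"
  shows "\<exists>d>0. d < \<epsilon> \<and> t * a powr p + (1 - t) * (\<epsilon> + d) powr p \<le> (\<epsilon> - d) powr p"
proof -
  have "((\<lambda>d. (\<epsilon> - d) powr p - (t * a powr p + (1 - t) * (\<epsilon> + d) powr p))
      \<longlongrightarrow> (\<epsilon> - 0) powr p - (t * a powr p + (1 - t) * (\<epsilon> + 0) powr p)) (at_right 0)"
    using assms by (intro tendsto_intros) auto
  moreover have "t * a powr p < t * \<epsilon> powr p"
    using assms by (intro mult_strict_left_mono powr_less_mono2) auto
  then have "(\<epsilon> - 0) powr p - (t * a powr p + (1 - t) * (\<epsilon> + 0) powr p) > 0"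
    by (simp add: algebra_simps)
  ultimately have "\<forall>\<^sub>F d in at_right 0. (\<epsilon> - d) powr p - (t * a powr p + (1 - t) * (\<epsilon> + d) powr p) > 0"
    by (rule order_tendstoD)
  moreover have "\<forall>\<^sub>F d in at_right 0. d > (0::real)"
    by (rule eventually_at_right_less)
  moreover have "\<forall>\<^sub>F d in at_right 0. d < \<epsilon>"
    using assms by (intro eventually_at_rightI[of 0 \<epsilon>]) auto
  ultimately have "\<forall>\<^sub>F d in at_right 0. d > 0 \<and> d < \<epsilon>
      \<and> t * a powr p + (1 - t) * (\<epsilon> + d) powr p \<le> (\<epsilon> - d) powr p"
    by eventually_elim auto
  then show ?thesis
    using eventually_happens'[OF trivial_limit_at_right_real[of 0]] by blast
qed

section \<open>Strict feasibility by mixing\<close>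

context transport_space begin

lemma mix_prob_measures:
  assumes P: "P \<in> \<P>" and Q: "Q \<in> \<P>" and t: "0 \<le> t" "t \<le> 1"
  shows "mix t P Q \<in> \<P>"
proof -
  note PQ = prob_measuresD(1)[OF P] prob_measuresD(1)[OF Q] prob_measuresD(2)[OF P] prob_measuresD(2)[OF Q]
  obtain x where x: "x \<in> X" using nonempty by blast
  have "(\<integral>\<^sup>+y. ennreal (\<rho> y x powr p) \<partial>mix t P Q)
      = ennreal t * (\<integral>\<^sup>+y. ennreal (\<rho> y x powr p) \<partial>P) + ennreal (1 - t) * (\<integral>\<^sup>+y. ennreal (\<rho> y x powr p) \<partial>Q)"
    using x t by (intro nn_integral_mix[OF PQ]) measurable
  also have "\<dots> < \<infinity>"
    using moment_finite[OF P x] moment_finite[OF Q x] by (simp add: ennreal_mult_less_top)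
  finally show ?thesis
    unfolding prob_measures_p_def using prob_space_mix[OF PQ] sets_mix[OF PQ(3,4)] x by blast
qed

text \<open>Mixing couplings shows that \<open>W\<^sup>p\<close> is convex in its first argument.\<close>

lemma wasserstein_mix_le:
  assumes P: "P \<in> \<P>" and Q: "Q \<in> \<P>" and R: "R \<in> \<P>" and t: "0 \<le> t" "t \<le> 1"
    and a: "W P R < a" and b: "W Q R < b" and c: "0 \<le> c" "t * a powr p + (1 - t) * b powr p \<le> c powr p"
  shows "W (mix t P Q) R \<le> c"
proof -
  obtain \<pi>1 where \<pi>1: "\<pi>1 \<in> couplings X P R" "cost \<pi>1 \<le> ennreal (a powr p)"
    using wasserstein_lessD[OF P R a] by blast
  obtain \<pi>2 where \<pi>2: "\<pi>2 \<in> couplings X Q R" "cost \<pi>2 \<le> ennreal (b powr p)"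
    using wasserstein_lessD[OF Q R b] by blast
  note \<pi>12 = coupling_prob_space[OF \<pi>1(1) prob_measuresD(1)[OF P]]
    coupling_prob_space[OF \<pi>2(1) prob_measuresD(1)[OF Q]] couplingsD(1)[OF \<pi>1(1)] couplingsD(1)[OF \<pi>2(1)]
  have \<pi>: "mix t \<pi>1 \<pi>2 \<in> couplings X (mix t P Q) R"
    unfolding couplings_def mem_Collect_eq
  proof (intro conjI)
    show "sets (mix t \<pi>1 \<pi>2) = sets (borel_on X \<Otimes>\<^sub>M borel_on X)"
      by (rule sets_mix[OF \<pi>12(3,4)])
    show "distr (mix t \<pi>1 \<pi>2) (borel_on X) fst = mix t P Q"
      unfolding distr_mix[OF \<pi>12 measurable_fst] couplingsD(3)[OF \<pi>1(1)] couplingsD(3)[OF \<pi>2(1)] ..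
    show "distr (mix t \<pi>1 \<pi>2) (borel_on X) snd = R"
      unfolding distr_mix[OF \<pi>12 measurable_snd] couplingsD(4)[OF \<pi>1(1)] couplingsD(4)[OF \<pi>2(1)]
      by (rule mix_same[OF prob_measuresD(1)[OF R]])
  qed
  have "cost (mix t \<pi>1 \<pi>2) = ennreal t * cost \<pi>1 + ennreal (1 - t) * cost \<pi>2"
    using t by (intro nn_integral_mix[OF \<pi>12]) measurable
  also have "\<dots> \<le> ennreal t * ennreal (a powr p) + ennreal (1 - t) * ennreal (b powr p)"
    using \<pi>1(2) \<pi>2(2) by (intro add_mono mult_left_mono) auto
  also have "\<dots> = ennreal (t * a powr p + (1 - t) * b powr p)"
    using t by (simp add: ennreal_mult[symmetric] ennreal_plus[symmetric] del: ennreal_plus)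
  also have "\<dots> \<le> ennreal (c powr p)" using c(2) by (rule ennreal_leI)
  finally show ?thesis by (rule wasserstein_leI[OF \<pi> _ c(1)])
qed

text \<open>Mixing a little of the center into \<open>Q\<close> makes the constraint strict, by
  convexity of the p-th power of \<open>W\<close>, while a small weight keeps the mixture close to
  \<open>Q\<close>.\<close>

lemma move_towards_center:
  assumes P: "P \<in> \<P>" and Q: "Q \<in> \<P>" and le: "W Q P \<le> \<epsilon>" and pos: "\<epsilon> > 0" "\<eta> > 0"
  shows "\<exists>Q'\<in>\<P>. W Q' P < \<epsilon> \<and> W Q' Q < \<eta>"
proof -
  define b where "b = W P Q + 1"
  have b: "b > 0" using wasserstein_nonneg[of P Q] by (simp add: b_def)
  \<comment> \<open>In p-th powers, \<open>g\<close> is the room between the bound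
    \<open>\<eta> / 4\<close> on \<open>W Q Q = 0\<close> and the target \<open>\<eta> / 2\<close>;
    the weight \<open>t\<close> keeps the contribution \<open>t * b powr p\<close> of the center
    within it.\<close>
  define g where "g = (\<eta> / 2) powr p - (\<eta> / 4) powr p"
  have g: "g > 0" unfolding g_def using pos p_ge_1 by (simp add: powr_less_mono2)
  define t where "t = min (1 / 2) (g / b powr p)"
  have t: "0 < t" "t < 1" "t * b powr p \<le> g"
  proof -
    show "0 < t" using g b by (simp add: t_def)
    have "t \<le> 1 / 2" unfolding t_def by (rule min.cobounded1)
    then show "t < 1" by linarith
    have "t * b powr p \<le> g / b powr p * b powr p"
      by (intro mult_right_mono) (simp_all add: t_def)
    then show "t * b powr p \<le> g" using b by simp
  qed
  \<comment> \<open>Here \<open>\<epsilon> / 2\<close> is a strict bound on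
    \<open>W P P = 0\<close>, and \<open>\<epsilon> + d\<close> is one on
    \<open>W Q P\<close>.\<close>
  obtain d where d: "d > 0" "d < \<epsilon>" "t * (\<epsilon> / 2) powr p + (1 - t) * (\<epsilon> + d) powr p \<le> (\<epsilon> - d) powr p"
    using powr_slack[of "\<epsilon> / 2" \<epsilon> t p] pos t p_ge_1 by auto
  have "W (mix t P Q) P \<le> \<epsilon> - d"
  proof (rule wasserstein_mix_le[OF P Q P _ _ _ _ _ d(3)])
    show "W P P < \<epsilon> / 2" using wasserstein_self[OF P] pos(1) by simp
  qed (use t d le in simp_all)
  moreover have "W (mix t P Q) Q \<le> \<eta> / 2"
  proof (rule wasserstein_mix_le[OF P Q Q])
    show "W Q Q < \<eta> / 4" using wasserstein_self[OF Q] pos(2) by simp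
    show "W P Q < b" by (simp add: b_def)
    have "(1 - t) * (\<eta> / 4) powr p \<le> (\<eta> / 4) powr p"
      using t by (intro mult_left_le_one_le) simp_all
    then show "t * b powr p + (1 - t) * (\<eta> / 4) powr p \<le> (\<eta> / 2) powr p"
      using t(3) by (simp add: g_def)
  qed (use t pos in simp_all)
  moreover have "mix t P Q \<in> \<P>" using t by (intro mix_prob_measures[OF P Q]) simp_all
  ultimately show ?thesis using d(1) pos(2) by (intro bexI[of _ "mix t P Q"]) auto
qed

text \<open>Constraints are made strict one at a time by moving towards the corresponding center.
  Staying within distance \<open>r\<close> of \<open>Q0\<close> guarantees the weak constraint that
  the next move starts from.\<close>

lemma slater_point:
  assumes I: "finite I" and P: "\<And>k. k \<in> I \<Longrightarrow> P k \<in> \<P>" and pos: "\<And>k. k \<in> I \<Longrightarrow> \<epsilon> k > 0"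
    and Q0: "Q0 \<in> \<P>" and r: "r > 0"
    and ball: "\<And>Q k. Q \<in> \<P> \<Longrightarrow> W Q Q0 < r \<Longrightarrow> k \<in> I \<Longrightarrow> W Q (P k) \<le> \<epsilon> k"
  shows "\<exists>Q\<in>\<P>. \<forall>k\<in>I. W Q (P k) < \<epsilon> k"
proof -
  have "\<exists>Q\<in>\<P>. W Q Q0 < r \<and> (\<forall>k\<in>S. W Q (P k) < \<epsilon> k)" if "finite S" "S \<subseteq> I" for S
    using that
  proof (induction S)
    case empty
    then show ?case using Q0 r wasserstein_self[OF Q0] by (intro bexI[of _ Q0]) auto
  next
    case (insert j S)
    then obtain Q where Q: "Q \<in> \<P>" "W Q Q0 < r" "\<And>k. k \<in> S \<Longrightarrow> W Q (P k) < \<epsilon> k" by auto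
    have j: "j \<in> I" and SI: "\<And>k. k \<in> S \<Longrightarrow> k \<in> I" using insert.prems by auto
    \<comment> \<open>A move shorter than the smallest margin stays in the ball around
      \<open>Q0\<close> and keeps the constraints in \<open>S\<close> strict.\<close>
    define \<eta> where "\<eta> = Min (insert (r - W Q Q0) ((\<lambda>k. \<epsilon> k - W Q (P k)) ` S))"
    have "\<eta> > 0" using insert.hyps(1) Q(2,3) by (simp add: \<eta>_def)
    then obtain Q' where Q': "Q' \<in> \<P>" "W Q' (P j) < \<epsilon> j" "W Q' Q < \<eta>"
      using move_towards_center[OF P[OF j] Q(1) ball[OF Q(1,2) j] pos[OF j]] by blast
    have "\<eta> \<le> r - W Q Q0" using insert.hyps(1) by (simp add: \<eta>_def)
    then have "W Q' Q0 < r"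
      using wasserstein_triangle[OF Q'(1) Q(1) Q0] Q'(3) by linarith
    moreover have "W Q' (P k) < \<epsilon> k" if "k \<in> S" for k
    proof -
      have "\<eta> \<le> \<epsilon> k - W Q (P k)" using insert.hyps(1) that by (simp add: \<eta>_def)
      then show ?thesis
        using wasserstein_triangle[OF Q'(1) Q(1) P[OF SI[OF that]]] Q'(3) by linarith
    qed
    ultimately show ?case using Q'(1,2) by (intro bexI[of _ Q']) auto
  qed
  then show ?thesis using I by blast
qed

end

section \<open>Continuity of the optimal value\<close>

lemma (in prob_space) abs_integral_le_bound:
  fixes f :: "'a \<Rightarrow> real"
  assumes f: "f \<in> borel_measurable M" "\<And>x. x \<in> space M \<Longrightarrow> \<bar>f x\<bar> \<le> B"
  shows "\<bar>\<integral>x. f x \<partial>M\<bar> \<le> B"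
proof -
  have int: "integrable M f"
    using f by (intro integrable_const_bound[of _ B]) (auto intro!: AE_I2)
  have "f x \<le> B \<and> - B \<le> f x" if "x \<in> space M" for x
    using f(2)[OF that] by linarith
  then have "(\<integral>x. f x \<partial>M) \<le> B" "(\<integral>x. f x \<partial>M) \<ge> - B"
    using int by (auto intro!: integral_le_const integral_ge_const AE_I2)
  then show ?thesis by linarith
qed

context transport_space begin

text \<open>For \<open>K = 0\<close> the intersection over the empty index set would contain all
  measures, even those outside \<open>\<P>\<close>.\<close>

lemma ball_intersection_iff:
  assumes "K \<ge> 1"
  shows "Q \<in> ball_intersection X \<rho> p K \<epsilon> R \<longleftrightarrow> Q \<in> \<P> \<and> (\<forall>k\<in>{1..K}. W Q (R k) \<le> \<epsilon> k)"
proof -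
  have "1 \<in> {1..K}" using assms by simp
  then show ?thesis unfolding ball_intersection_def wasserstein_ball_def by blast
qed

text \<open>A one-sided estimate, meant to be used twice with the centers exchanged. Here
  \<open>d\<close> bounds the shift of the centers, \<open>a\<close> the distance from the Slater
  point to the new ones, and \<open>slack\<close> is what convexity requires for
  \<open>mix t S Q\<close> to be feasible.\<close>

lemma optimal_value_le:
  fixes loss :: "'b \<Rightarrow> 'a \<Rightarrow> real"
  assumes K: "K \<ge> 1" and \<Theta>: "\<Theta> \<noteq> {}"
    and meas: "\<And>\<theta>. \<theta> \<in> \<Theta> \<Longrightarrow> loss \<theta> \<in> borel_measurable (borel_on X)"
    and bound: "\<And>\<theta> x. \<theta> \<in> \<Theta> \<Longrightarrow> x \<in> X \<Longrightarrow> \<bar>loss \<theta> x\<bar> \<le> M"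
    and S: "S \<in> \<P>" and t: "0 < t" "t < 1"
    and R: "\<And>k. k \<in> {1..K} \<Longrightarrow> R k \<in> \<P>" and R': "\<And>k. k \<in> {1..K} \<Longrightarrow> R' k \<in> \<P>"
    and ne: "ball_intersection X \<rho> p K \<epsilon> R \<noteq> {}" and \<epsilon>: "\<And>k. k \<in> {1..K} \<Longrightarrow> \<epsilon> k > 0"
    and slater: "\<And>k. k \<in> {1..K} \<Longrightarrow> W S (R' k) < a k"
    and close: "\<And>k. k \<in> {1..K} \<Longrightarrow> W (R k) (R' k) < d k"
    and slack: "\<And>k. k \<in> {1..K} \<Longrightarrow> t * a k powr p + (1 - t) * (\<epsilon> k + d k) powr p \<le> \<epsilon> k powr p"
  shows "optimal_value \<Theta> X \<rho> p K \<epsilon> loss R \<le> optimal_value \<Theta> X \<rho> p K \<epsilon> loss R' + 2 * t * M"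
proof -
  let ?F = "ball_intersection X \<rho> p K \<epsilon> R" and ?F' = "ball_intersection X \<rho> p K \<epsilon> R'"
  define J where "J \<theta> Q = (\<integral>x. loss \<theta> x \<partial>Q)" for \<theta> Q
  have J_bound: "\<bar>J \<theta> Q\<bar> \<le> M" if \<theta>: "\<theta> \<in> \<Theta>" and Q: "Q \<in> \<P>" for \<theta> Q
  proof -
    interpret Q: prob_space Q using prob_measuresD(1)[OF Q] .
    have "loss \<theta> \<in> borel_measurable Q"
      using meas[OF \<theta>] unfolding measurable_cong_sets[OF prob_measuresD(2)[OF Q] refl] .
    then show ?thesis
      unfolding J_def using bound[OF \<theta>] prob_measuresD(3)[OF Q]
      by (intro Q.abs_integral_le_bound) simp_all
  qed
  have F: "Q \<in> \<P>" if "Q \<in> ?F" for Q using that unfolding ball_intersection_iff[OF K] by blast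
  have F': "Q \<in> \<P>" if "Q \<in> ?F'" for Q using that unfolding ball_intersection_iff[OF K] by blast
  have bdd: "bdd_above (J \<theta> ` ?F)" if "\<theta> \<in> \<Theta>" for \<theta>
    using J_bound[OF that F] by (intro bdd_aboveI2[of _ _ M]) (simp add: abs_le_iff)
  have bdd': "bdd_above (J \<theta> ` ?F')" if "\<theta> \<in> \<Theta>" for \<theta>
    using J_bound[OF that F'] by (intro bdd_aboveI2[of _ _ M]) (simp add: abs_le_iff)
  have mix_feasible: "mix t S Q \<in> ?F'" if Q: "Q \<in> ?F" for Q
    unfolding ball_intersection_iff[OF K]
  proof (intro conjI ballI)
    show "mix t S Q \<in> \<P>" using t by (intro mix_prob_measures[OF S F[OF Q]]) simp_all
    fix k assume k: "k \<in> {1..K}"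
    have "W Q (R k) \<le> \<epsilon> k" using Q k unfolding ball_intersection_iff[OF K] by blast
    then have "W Q (R' k) < \<epsilon> k + d k"
      using wasserstein_triangle[OF F[OF Q] R[OF k] R'[OF k]] close[OF k] by linarith
    then show "W (mix t S Q) (R' k) \<le> \<epsilon> k"
      using t \<epsilon>[OF k]
      by (intro wasserstein_mix_le[OF S F[OF Q] R'[OF k] _ _ slater[OF k] _ _ slack[OF k]]) simp_all
  qed
  have sup_le: "(SUP Q\<in>?F. J \<theta> Q) \<le> (SUP Q\<in>?F'. J \<theta> Q) + 2 * t * M" if \<theta>: "\<theta> \<in> \<Theta>" for \<theta>
  proof (rule cSUP_least[OF ne])
    fix Q assume Q: "Q \<in> ?F"
    have "J \<theta> (mix t S Q) = t * J \<theta> S + (1 - t) * J \<theta> Q"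
      unfolding J_def using t bound[OF \<theta>] meas[OF \<theta>] prob_measuresD[OF S] prob_measuresD[OF F[OF Q]]
      by (intro integral_mix[of S Q "borel_on X" _ M]) (simp_all add: space_restrict_space)
    then have "J \<theta> Q = J \<theta> (mix t S Q) + t * (J \<theta> Q - J \<theta> S)"
      by (simp add: algebra_simps)
    moreover have "t * (J \<theta> Q - J \<theta> S) \<le> t * (2 * M)"
      using t J_bound[OF \<theta> F[OF Q]] J_bound[OF \<theta> S] by (intro mult_left_mono) linarith+
    moreover have "J \<theta> (mix t S Q) \<le> (SUP Q\<in>?F'. J \<theta> Q)"
      by (rule cSUP_upper[OF mix_feasible[OF Q] bdd'[OF \<theta>]])
    ultimately show "J \<theta> Q \<le> (SUP Q\<in>?F'. J \<theta> Q) + 2 * t * M" by linarith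
  qed
  obtain Q where Q: "Q \<in> ?F" using ne by blast
  \<comment> \<open>Any fixed feasible \<open>Q\<close> bounds all the suprema below by
    \<open>- M\<close>, so that the real infimum is indeed a lower bound.\<close>
  have "bdd_below ((\<lambda>\<theta>. SUP Q\<in>?F. J \<theta> Q) ` \<Theta>)"
  proof (rule bdd_belowI2)
    fix \<theta> assume \<theta>: "\<theta> \<in> \<Theta>"
    have "- M \<le> J \<theta> Q" using J_bound[OF \<theta> F[OF Q]] by linarith
    also have "\<dots> \<le> (SUP Q\<in>?F. J \<theta> Q)" by (rule cSUP_upper[OF Q bdd[OF \<theta>]])
    finally show "- M \<le> (SUP Q\<in>?F. J \<theta> Q)" .
  qed
  then have "(INF \<theta>\<in>\<Theta>. SUP Q\<in>?F. J \<theta> Q) - 2 * t * M \<le> (INF \<theta>\<in>\<Theta>. SUP Q\<in>?F'. J \<theta> Q)"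
  proof (intro cINF_greatest[OF \<Theta>])
    fix \<theta> assume \<theta>: "\<theta> \<in> \<Theta>" and bb: "bdd_below ((\<lambda>\<theta>. SUP Q\<in>?F. J \<theta> Q) ` \<Theta>)"
    have "(INF \<theta>\<in>\<Theta>. SUP Q\<in>?F. J \<theta> Q) \<le> (SUP Q\<in>?F. J \<theta> Q)"
      by (rule cINF_lower[OF bb \<theta>])
    then show "(INF \<theta>\<in>\<Theta>. SUP Q\<in>?F. J \<theta> Q) - 2 * t * M \<le> (SUP Q\<in>?F'. J \<theta> Q)"
      using sup_le[OF \<theta>] by linarith
  qed
  then show ?thesis unfolding optimal_value_def J_def by linarith
qed

text \<open>Around an interior point a whole \<open>W\<close>-ball is feasible, which is the
  hypothesis of \<open>slater_point\<close>.\<close>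

lemma admissible_centersD:
  assumes K: "K \<ge> 1" and P: "P \<in> admissible_centers X \<rho> p K \<epsilon>" and \<epsilon>: "\<forall>k\<in>{1..K}. \<epsilon> k > 0"
  shows "\<And>k. k \<in> {1..K} \<Longrightarrow> P k \<in> \<P>" "ball_intersection X \<rho> p K \<epsilon> P \<noteq> {}"
    "\<exists>S\<in>\<P>. \<forall>k\<in>{1..K}. W S (P k) < \<epsilon> k"
proof -
  interpret W: Metric_space \<P> W by (rule Metric_space_wasserstein)
  show P\<P>: "P k \<in> \<P>" if "k \<in> {1..K}" for k
    using P that unfolding admissible_centers_def by blast
  obtain Q0 T where T: "openin W.mtopology T" "Q0 \<in> T" "T \<subseteq> ball_intersection X \<rho> p K \<epsilon> P"
    using P unfolding admissible_centers_def wasserstein_topology_def interior_of_def by blast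
  then show "ball_intersection X \<rho> p K \<epsilon> P \<noteq> {}" by blast
  obtain r where r: "r > 0" "W.mball Q0 r \<subseteq> T" and Q0: "Q0 \<in> \<P>"
    using T(1,2) unfolding W.openin_mtopology by blast
  show "\<exists>S\<in>\<P>. \<forall>k\<in>{1..K}. W S (P k) < \<epsilon> k"
  proof (rule slater_point[OF _ P\<P> bspec[OF \<epsilon>] Q0 r(1)])
    fix Q k assume Q: "Q \<in> \<P>" "W Q Q0 < r" and k: "k \<in> {1..K}"
    have "Q \<in> W.mball Q0 r"
      unfolding W.in_mball using Q Q0 wasserstein_commute[of Q0 Q] by simp
    then have "Q \<in> ball_intersection X \<rho> p K \<epsilon> P" using r(2) T(3) by blast
    then show "W Q (P k) \<le> \<epsilon> k" using k unfolding ball_intersection_iff[OF K] by blast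
  qed simp_all
qed

lemma continuous_map_optimal_value:
  fixes loss :: "'b \<Rightarrow> 'a \<Rightarrow> real"
  assumes K: "K \<ge> 1" and \<Theta>: "\<Theta> \<noteq> {}"
    and meas: "\<And>\<theta>. \<theta> \<in> \<Theta> \<Longrightarrow> loss \<theta> \<in> borel_measurable (borel_on X)"
    and bound: "\<And>\<theta> x. \<theta> \<in> \<Theta> \<Longrightarrow> x \<in> X \<Longrightarrow> \<bar>loss \<theta> x\<bar> \<le> M"
    and \<epsilon>: "\<And>k. k \<in> {1..K} \<Longrightarrow> \<epsilon> k > 0"
  shows "continuous_map
           (subtopology (product_topology (\<lambda>_. wasserstein_topology X \<rho> p) {1..K})
              (admissible_centers X \<rho> p K \<epsilon>))
           euclideanreal
           (optimal_value \<Theta> X \<rho> p K \<epsilon> loss)"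
proof -
  interpret W: Metric_space \<P> W by (rule Metric_space_wasserstein)
  let ?V = "optimal_value \<Theta> X \<rho> p K \<epsilon> loss" and ?U = "admissible_centers X \<rho> p K \<epsilon>"
  let ?top = "product_topology (\<lambda>_. wasserstein_topology X \<rho> p) {1..K}"
  have \<epsilon>_pos: "\<forall>k\<in>{1..K}. \<epsilon> k > 0" using \<epsilon> by blast
  have "M \<ge> 0"
    using bound \<Theta> nonempty by (meson abs_ge_zero all_not_in_conv order_trans)
  have nbhd: "\<exists>N. openin (subtopology ?top ?U) N \<and> P \<in> N \<and> (\<forall>P'\<in>N. \<bar>?V P - ?V P'\<bar> < e)"
    if P: "P \<in> ?U" and e: "e > 0" for P e
  proof -
    note PD = admissible_centersD[OF K P \<epsilon>_pos]
    obtain S where S: "S \<in> \<P>" "\<And>k. k \<in> {1..K} \<Longrightarrow> W S (P k) < \<epsilon> k"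
      using PD(3) by blast
    \<comment> \<open>The summand 1 covers \<open>M = 0\<close>; the choice gives
      \<open>2 * t * M < e\<close> and, through the cap \<open>1 / 2\<close>, also
      \<open>t < 1\<close>.\<close>
    define t where "t = min (1 / 2) (e / (4 * (M + 1)))"
    have t0: "0 < t" using e \<open>M \<ge> 0\<close> by (simp add: t_def)
    have "t \<le> 1 / 2" unfolding t_def by (rule min.cobounded1)
    then have t1: "t < 1" by linarith
    have "t \<le> e / (4 * (M + 1))" unfolding t_def by (rule min.cobounded2)
    moreover have "4 * (M + 1) > 0" using \<open>M \<ge> 0\<close> by simp
    ultimately have "t * (4 * (M + 1)) \<le> e" by (metis pos_le_divide_eq)
    moreover have "t * (4 * (M + 1)) = 4 * (t * M) + 4 * t" by (simp add: distrib_left)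
    moreover have "0 \<le> t * M" using t0 \<open>M \<ge> 0\<close> by simp
    ultimately have tM: "2 * t * M < e" using t0 by linarith
    \<comment> \<open>The midpoint leaves room on both sides: below \<open>\<epsilon> k\<close> for
      \<open>powr_slack\<close>, above \<open>W S (P k)\<close> for shifting the center.\<close>
    define a where "a k = (W S (P k) + \<epsilon> k) / 2" for k
    have a: "0 \<le> a k" "a k < \<epsilon> k" "W S (P k) < a k" if "k \<in> {1..K}" for k
      using S(2)[OF that] wasserstein_nonneg[of S "P k"] \<epsilon>[OF that] by (simp_all add: a_def)
    have "\<exists>d>0. t * a k powr p + (1 - t) * (\<epsilon> k + d) powr p \<le> \<epsilon> k powr p" if k: "k \<in> {1..K}" for k
    proof -
      obtain d where d: "d > 0" "d < \<epsilon> k" "t * a k powr p + (1 - t) * (\<epsilon> k + d) powr p \<le> (\<epsilon> k - d) powr p"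
        using powr_slack[OF a(1,2)[OF k] t0 t1 p_ge_1] by blast
      moreover have "(\<epsilon> k - d) powr p \<le> \<epsilon> k powr p"
        using d p_ge_1 by (intro powr_mono2) auto
      ultimately show ?thesis by (meson order_trans)
    qed
    then obtain d where d: "\<And>k. k \<in> {1..K} \<Longrightarrow> d k > 0"
      "\<And>k. k \<in> {1..K} \<Longrightarrow> t * a k powr p + (1 - t) * (\<epsilon> k + d k) powr p \<le> \<epsilon> k powr p"
      by metis
    \<comment> \<open>Within \<open>d k\<close> the shift of the center is tolerated by the slack,
      and within \<open>a k - W S (P k)\<close> the point \<open>S\<close> stays closer than
      \<open>a k\<close> to the new center.\<close>
    define N where "N = ?U \<inter> (\<Pi>\<^sub>E k\<in>{1..K}. W.mball (P k) (min (d k) (a k - W S (P k))))"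
    have "openin ?top (\<Pi>\<^sub>E k\<in>{1..K}. W.mball (P k) (min (d k) (a k - W S (P k))))"
      unfolding wasserstein_topology_def by (subst openin_PiE) simp_all
    then have "openin (subtopology ?top ?U) N"
      unfolding N_def by (rule openin_subtopology_Int2)
    moreover have "P \<in> N"
    proof -
      have "P \<in> extensional {1..K}" using P by (auto simp: admissible_centers_def PiE_def)
      moreover have "P k \<in> W.mball (P k) (min (d k) (a k - W S (P k)))" if "k \<in> {1..K}" for k
        unfolding W.in_mball using PD(1)[OF that] wasserstein_self[OF PD(1)[OF that]] d(1)[OF that] a(3)[OF that]
        by simp
      ultimately show ?thesis unfolding N_def PiE_def Pi_def using P by blast
    qed
    moreover have "\<bar>?V P - ?V P'\<bar> < e" if "P' \<in> N" for P'
    proof -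
      have P': "P' \<in> ?U" using that by (simp add: N_def)
      note P'D = admissible_centersD[OF K P' \<epsilon>_pos]
      have near: "W (P k) (P' k) < d k" "W (P k) (P' k) < a k - W S (P k)" if "k \<in> {1..K}" for k
      proof -
        have "P' k \<in> W.mball (P k) (min (d k) (a k - W S (P k)))"
          using \<open>P' \<in> N\<close> that unfolding N_def by blast
        then show "W (P k) (P' k) < d k" "W (P k) (P' k) < a k - W S (P k)"
          by (simp_all add: W.in_mball)
      qed
      have near': "W (P' k) (P k) < d k" if "k \<in> {1..K}" for k
        using near(1)[OF that] wasserstein_commute[of "P k" "P' k"] by simp
      have S': "W S (P' k) < a k" if "k \<in> {1..K}" for k
        using wasserstein_triangle[OF S(1) PD(1)[OF that] P'D(1)[OF that]] near(2)[OF that] by linarith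
      \<comment> \<open>The same \<open>t\<close>, \<open>a\<close> and \<open>d\<close> serve both
        directions, since \<open>S\<close> is closer than \<open>a k\<close> to both
        \<open>P k\<close> and \<open>P' k\<close>.\<close>
      have "?V P \<le> ?V P' + 2 * t * M"
        by (rule optimal_value_le[where a=a and d=d, OF K \<Theta> meas bound S(1) t0 t1 PD(1) P'D(1) PD(2) \<epsilon> S' near(1) d(2)])
      moreover have "?V P' \<le> ?V P + 2 * t * M"
        by (rule optimal_value_le[where a=a and d=d, OF K \<Theta> meas bound S(1) t0 t1 P'D(1) PD(1) P'D(2) \<epsilon> a(3) near' d(2)])
      ultimately show ?thesis using tM by linarith
    qed
    ultimately show ?thesis by blast
  qed
  show ?thesis
    unfolding mtopology_is_euclidean[symmetric] Met_TC.continuous_map_to_metric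
  proof (intro ballI allI impI)
    fix P and e :: real
    assume "P \<in> topspace (subtopology ?top ?U)" and e: "e > 0"
    then have "P \<in> ?U" by simp
    from nbhd[OF this e] show "\<exists>N. openin (subtopology ?top ?U) N \<and> P \<in> N \<and> (\<forall>P'\<in>N. ?V P' \<in> Met_TC.mball (?V P) e)"
      by (simp add: dist_real_def)
  qed
qed

end

section \<open>From compact data to a transport space\<close>

text \<open>Compactness makes \<open>\<Xi>\<close> Borel and, with joint continuity, the loss
  uniformly bounded; continuity in the second argument makes it measurable.\<close>

theorem theorem6:
  fixes \<Theta> :: "(real ^ 'n) set"
    and \<Xi> :: "(real ^ 'd) set"
    and \<rho> :: "real ^ 'd \<Rightarrow> real ^ 'd \<Rightarrow> real"
    and p :: real
    and loss :: "real ^ 'n \<Rightarrow> real ^ 'd \<Rightarrow> real"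
    and K :: nat
    and \<epsilon> :: "nat \<Rightarrow> real"
  assumes "\<Theta> \<noteq> {}" and "compact \<Theta>"
    and "\<Xi> \<noteq> {}" and "compact \<Xi>" and "convex \<Xi>"
    and "Metric_space \<Xi> \<rho>"
    and "Metric_space.mcomplete \<Xi> \<rho>"
    and "separable_space (Metric_space.mtopology \<Xi> \<rho>)"
    and "geodesic_on \<Xi> \<rho>"
      (* needed for the integrals defining the Wasserstein distance to make sense;
         automatic if \<rho> induces the usual topology of \<Xi> *)
    and "(\<lambda>(x, y). \<rho> x y) \<in> borel_measurable (borel_on (\<Xi> \<times> \<Xi>))"
    and "p \<ge> 1"
    and "continuous_on (\<Theta> \<times> \<Xi>) (\<lambda>(\<theta>, \<xi>). loss \<theta> \<xi>)"
    and "K \<ge> 1"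
    and "\<And>k. k \<in> {1..K} \<Longrightarrow> \<epsilon> k > 0"
  shows "continuous_map
           (subtopology (product_topology (\<lambda>_. wasserstein_topology \<Xi> \<rho> p) {1..K})
              (admissible_centers \<Xi> \<rho> p K \<epsilon>))
           euclideanreal
           (optimal_value \<Theta> \<Xi> \<rho> p K \<epsilon> loss)"
proof -
  have \<Xi>_borel: "\<Xi> \<in> sets borel"
    using \<open>compact \<Xi>\<close> by (intro borel_closed compact_imp_closed)
  have incl: "(\<lambda>x. x) \<in> borel_on \<Xi> \<rightarrow>\<^sub>M borel"
    by (intro measurable_restrict_space1) simp
  \<comment> \<open>The measurability hypothesis concerns the Borel sets of
    \<open>\<Xi> \<times> \<Xi>\<close>, whereas couplings live on the product sigma-algebra; by
    \<open>borel_prod\<close> the identity is measurable from the latter to the former.\<close>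
  have "(\<lambda>z. (fst z, snd z)) \<in> borel_on \<Xi> \<Otimes>\<^sub>M borel_on \<Xi> \<rightarrow>\<^sub>M borel \<Otimes>\<^sub>M borel"
    by (intro measurable_Pair measurable_compose[OF measurable_fst incl] measurable_compose[OF measurable_snd incl])
  then have "(\<lambda>z. z) \<in> borel_on \<Xi> \<Otimes>\<^sub>M borel_on \<Xi> \<rightarrow>\<^sub>M borel_on (\<Xi> \<times> \<Xi>)"
    by (intro measurable_restrict_space2) (simp_all add: space_pair_measure space_restrict_space borel_prod)
  from measurable_compose[OF this assms(10)]
  have "(\<lambda>z. \<rho> (fst z) (snd z)) \<in> borel_measurable (borel_on \<Xi> \<Otimes>\<^sub>M borel_on \<Xi>)"
    by (simp add: case_prod_beta')
  then interpret transport_space \<Xi> \<rho> p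
    using assms(3,6,8,11) \<Xi>_borel
    by (intro transport_space.intro transport_space_axioms.intro)
  have "compact (\<Theta> \<times> \<Xi>)" using assms(2,4) by (rule compact_Times)
  then have "compact ((\<lambda>(\<theta>, \<xi>). loss \<theta> \<xi>) ` (\<Theta> \<times> \<Xi>))"
    using assms(12) by (intro compact_continuous_image)
  then obtain M where M: "\<forall>y\<in>(\<lambda>(\<theta>, \<xi>). loss \<theta> \<xi>) ` (\<Theta> \<times> \<Xi>). norm y \<le> M"
    using compact_imp_bounded bounded_iff by metis
  show ?thesis
  proof (rule continuous_map_optimal_value[OF assms(13,1) _ _ assms(14)])
    fix \<theta> assume \<theta>: "\<theta> \<in> \<Theta>"
    have "continuous_on \<Xi> (\<lambda>\<xi>. (\<lambda>(\<theta>, \<xi>). loss \<theta> \<xi>) (\<theta>, \<xi>))"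
      using \<theta> by (intro continuous_on_compose2[OF assms(12)] continuous_intros) auto
    then show "loss \<theta> \<in> borel_measurable (borel_on \<Xi>)"
      by (intro borel_measurable_continuous_on_restrict) simp
    show "\<bar>loss \<theta> \<xi>\<bar> \<le> M" if "\<xi> \<in> \<Xi>" for \<xi>
      using M \<theta> that by fastforce
  qed
qed

end
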